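(* Let $n\in\mathbb{N}$. Then $$t(1,1,3,9;n)=\begin{cases} -\dfrac{8}{3}\displaystyle\sum_{d\mid 4n+7} d\left(\frac{3}{d}\right) & \text{if } 3\mid n,\\[2pt] \dfrac{8}{3}\displaystyle\sum_{d\mid 4n+7} d\left(\frac{3}{d}\right) & \text{if } 3\mid n-1,\\[2pt] 2\left(3^{\beta-1}\left(\dfrac{3}{n_1}\right)-1\right)\displaystyle\sum_{d\mid n_1} d\left(\frac{3}{d}\right) & \text{if } 3\mid n-2 \text{ and } 4n+7=3^\beta n_1 \text{ with } 3\nmid n_1,\end{cases}$$ where the sums are over positive divisors $d$.
   Context: $\mathbb{N}$ denotes the set of positive integers. For $a,b,c,d\in\mathbb{N}$ and an integer $m\ge0$, $t(a,b,c,d;m)$ is the number of $(x,y,z,w)\in\mathbb{Z}^4$ with $m = a\frac{x(x-1)}{2}+b\frac{y(y-1)}{2}+c\frac{z(z-1)}{2}+d\frac{w(w-1)}{2}$. $\left(\frac{a}{m}\right)$ denotes the Legendre–Jacobi–Kronecker symbol. *)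

theory Defs
  imports Complex_Main "HOL-Number_Theory.Number_Theory"
begin

text \<open>
  The Legendre-Jacobi-Kronecker symbol \<open>(a / m)\<close>, for arbitrary integers \<open>a\<close> and \<open>m\<close>.
  Note that the library's \<open>Legendre a 2\<close> is 1 for every odd \<open>a\<close>, whereas \<open>(a / 2)\<close>
  depends on \<open>a\<close> modulo 8.
\<close>

definition kronecker_prime :: "int \<Rightarrow> nat \<Rightarrow> int" where
  "kronecker_prime a p =
     (if p = 2
      then (if even a then 0 else if a mod 8 = 1 \<or> a mod 8 = 7 then 1 else - 1)
      else Legendre a (int p))"

definition kronecker :: "int \<Rightarrow> int \<Rightarrow> int" where
  "kronecker a m =
     (if m = 0 then (if \<bar>a\<bar> = 1 then 1 else 0)
      else (if m < 0 \<and> a < 0 then - 1 else 1) *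
           (\<Prod>p\<in>prime_factors (nat \<bar>m\<bar>). kronecker_prime a p ^ multiplicity p (nat \<bar>m\<bar>)))"

text \<open>
  The division by 2 is exact, since \<open>x * (x - 1)\<close> is even.  The set is finite whenever
  \<open>a, b, c, d\<close> are positive, so that its cardinality is the number of representations.
\<close>

definition t :: "nat \<Rightarrow> nat \<Rightarrow> nat \<Rightarrow> nat \<Rightarrow> nat \<Rightarrow> nat" where
  "t a b c d m = card {(x :: int, y :: int, z :: int, w :: int).
     int m = int a * (x * (x - 1) div 2) + int b * (y * (y - 1) div 2)
           + int c * (z * (z - 1) div 2) + int d * (w * (w - 1) div 2)}"

end

theory Submission
  imports Defs "HOL-Library.Discrete_Functions"
begin

text \<open>
  Put \<open>N = 4 n + 7\<close>. Completing squares, \<open>t 1 1 3 9 n\<close> counts the representations of \<open>2 N\<close> by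
  \<open>x\<^sup>2 + y\<^sup>2 + 3 z\<^sup>2 + 9 w\<^sup>2\<close> with all variables odd. Looking at the squares modulo 3, these
  reduce to representations of \<open>2 N\<close> by \<open>(x\<^sup>2 + y\<^sup>2) + (z\<^sup>2 + 3 w\<^sup>2)\<close> if 3 does not divide \<open>N\<close>, and of
  \<open>2 N / 3\<close> by \<open>3 (x\<^sup>2 + y\<^sup>2) + (z\<^sup>2 + 3 w\<^sup>2)\<close> otherwise. The binary forms have class number one,
  so both counts are convolutions of the divisor sums of \<open>(-4/d)\<close> and \<open>(-3/d)\<close>, that is, weighted
  counts of the solutions of \<open>d x + e y = N\<close> in positive integers. These are evaluated by
  Liouville's method: the bijection \<open>(d, e, x, y) \<mapsto> (d, d + e, x - y, y)\<close> from \<open>x > y\<close> to \<open>d < e\<close>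
  makes the sum of \<open>h(d, e, x, y) - h(d, d + e, x - y, y)\<close> collapse to the terms with \<open>d = e\<close> or
  \<open>x = y\<close>, which are divisor sums of \<open>N\<close>. It remains to write the weight as such a difference.
\<close>

section \<open>Solutions of dx + ey = N\<close>

text \<open>The symbol (3/d) enters through the diagonal \<open>d = e\<close>: for odd
  \<open>d\<close> the potentials reduce there to \<open>3 * chi4 d * chi3 d\<close>, and
  \<open>chi4 d * chi3 d\<close> equals (3/d). The equation \<open>x + y = N div d\<close> has
  \<open>N div d - 1\<close> positive solutions, so this diagonal yields a sum over complementary
  divisors. On \<open>x = y\<close> a function of period 12 is summed over an interval of length
  about \<open>m = d + e\<close>; the result is linear in \<open>m\<close> up to a periodic term and
  yields a sum over the divisors themselves. Every count is thus a combination of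
  \<open>codivsum\<close> and \<open>divsum\<close>. If \<open>chi12 N\<close> is nonzero, the two
  agree up to that sign, which separates the first two cases of the theorem; a factor 3 of the
  argument multiplies \<open>codivsum\<close> by 3 and leaves \<open>divsum\<close> unchanged, which
  is where the power of 3 in the last case comes from.

  A weight need not equal the product of characters pointwise: only its sums over all factorizations
  of a number matter. The rule \<open>chi3 (2 * d) = - chi3 d\<close> and the vanishing of
  \<open>sum_chi4\<close> at numbers that are 3 modulo 4 leave room to adjust it.\<close>

definition factor_quads :: "int \<Rightarrow> (int \<times> int \<times> int \<times> int) set" where
  "factor_quads N = {(d, e, x, y). 0 < d \<and> 0 < e \<and> 0 < x \<and> 0 < y \<and> d * x + e * y = N}"

definition factor_pairs :: "int \<Rightarrow> (int \<times> int) set" where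
  "factor_pairs a = {(d, x). 0 < d \<and> 0 < x \<and> d * x = a}"

lemma pos_factor_le:
  fixes d x :: int
  assumes "0 < d" "0 < x"
  shows "d \<le> d * x" "x \<le> d * x"
  using assms by (simp_all add: mult_le_cancel_left1 mult_le_cancel_right1)

lemma finite_factor_pairs [simp]: "finite (factor_pairs a)"
proof (rule finite_subset)
  show "factor_pairs a \<subseteq> {0..a} \<times> {0..a}"
    using pos_factor_le by (force simp: factor_pairs_def)
qed simp

lemma finite_factor_quads [simp]: "finite (factor_quads N)"
proof (rule finite_subset)
  show "factor_quads N \<subseteq> {0..N} \<times> {0..N} \<times> {0..N} \<times> {0..N}"
  proof
    fix q assume "q \<in> factor_quads N"
    then obtain d e x y where q: "q = (d, e, x, y)" "0 < d" "0 < e" "0 < x" "0 < y"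
      "d * x + e * y = N"
      by (auto simp: factor_quads_def)
    then have "d \<le> d * x" "x \<le> d * x" "e \<le> e * y" "y \<le> e * y" "0 < d * x" "0 < e * y"
      using pos_factor_le by simp_all
    with q have "d \<le> N" "x \<le> N" "e \<le> N" "y \<le> N"
      by linarith+
    with q show "q \<in> {0..N} \<times> {0..N} \<times> {0..N} \<times> {0..N}"
      by simp
  qed
qed simp

lemma sum_factor_pairs_swap: "(\<Sum>(d, x)\<in>factor_pairs a. f x d) = (\<Sum>(d, x)\<in>factor_pairs a. f d x)"
  by (rule sum.reindex_bij_witness[of _ "\<lambda>(d, x). (x, d)" "\<lambda>(d, x). (x, d)"])
    (auto simp: factor_pairs_def mult.commute)

text \<open>By symmetry the parts \<open>x > y\<close> and \<open>x < y\<close> of a sum agree, as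
  do the parts \<open>d < e\<close> and \<open>d > e\<close>, so only one of each pair has to be
  matched by the bijection. On \<open>x = y\<close> the step leaves the positive quadruples, its
  third entry becoming 0; hence \<open>h\<close> must be defined there too.\<close>

lemma sum_factor_quads_descent:
  fixes g h :: "int \<Rightarrow> int \<Rightarrow> int \<Rightarrow> int \<Rightarrow> int"
  assumes h_sym: "\<And>d e x y. h d e x y = h e d y x"
    and g_sym: "\<And>d e x y. g d e x y = g e d y x"
    and g_eq: "\<And>d e x y. d * x + e * y = N \<Longrightarrow> g d e x y = h d e x y - h d (d + e) (x - y) y"
  shows "(\<Sum>(d, e, x, y)\<in>factor_quads N. g d e x y) =
         (\<Sum>(d, e, x, y)\<in>{(d, e, x, y)\<in>factor_quads N. d = e}. h d d x y) -
         (\<Sum>(d, e, x, y)\<in>{(d, e, x, y)\<in>factor_quads N. x = y}. h d (d + e) 0 y)"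
proof -
  define X where "X = {(d, e, x, y)\<in>factor_quads N. x > y}"
  define X' where "X' = {(d, e, x, y)\<in>factor_quads N. x < y}"
  define X0 where "X0 = {(d, e, x, y)\<in>factor_quads N. x = y}"
  define U where "U = {(d, e, x, y)\<in>factor_quads N. e > d}"
  define U' where "U' = {(d, e, x, y)\<in>factor_quads N. e < d}"
  define U0 where "U0 = {(d, e, x, y)\<in>factor_quads N. d = e}"
  have fin: "finite X" "finite X'" "finite X0" "finite U" "finite U'" "finite U0"
    unfolding X_def X'_def X0_def U_def U'_def U0_def
    by (auto intro: finite_subset[OF _ finite_factor_quads[of N]])
  have splitX: "(\<Sum>(d, e, x, y)\<in>factor_quads N. f d e x y) = (\<Sum>(d, e, x, y)\<in>X. f d e x y) +
      (\<Sum>(d, e, x, y)\<in>X'. f d e x y) + (\<Sum>(d, e, x, y)\<in>X0. f d e x y)"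
    for f :: "int \<Rightarrow> int \<Rightarrow> int \<Rightarrow> int \<Rightarrow> int"
  proof -
    have "factor_quads N = (X \<union> X') \<union> X0" "(X \<union> X') \<inter> X0 = {}" "X \<inter> X' = {}"
      by (auto simp: X_def X'_def X0_def)
    then show ?thesis
      using fin by (simp add: sum.union_disjoint)
  qed
  have splitU: "(\<Sum>(d, e, x, y)\<in>factor_quads N. f d e x y) = (\<Sum>(d, e, x, y)\<in>U. f d e x y) +
      (\<Sum>(d, e, x, y)\<in>U'. f d e x y) + (\<Sum>(d, e, x, y)\<in>U0. f d e x y)"
    for f :: "int \<Rightarrow> int \<Rightarrow> int \<Rightarrow> int \<Rightarrow> int"
  proof -
    have "factor_quads N = (U \<union> U') \<union> U0" "(U \<union> U') \<inter> U0 = {}" "U \<inter> U' = {}"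
      by (auto simp: U_def U'_def U0_def)
    then show ?thesis
      using fin by (simp add: sum.union_disjoint)
  qed
  have symX: "(\<Sum>(d, e, x, y)\<in>X'. f d e x y) = (\<Sum>(d, e, x, y)\<in>X. f d e x y)"
    if "\<And>d e x y. f d e x y = f e d y x" for f :: "int \<Rightarrow> int \<Rightarrow> int \<Rightarrow> int \<Rightarrow> int"
    by (rule sum.reindex_bij_witness[of _ "\<lambda>(d, e, x, y). (e, d, y, x)" "\<lambda>(d, e, x, y). (e, d, y, x)"])
      (auto simp: X_def X'_def factor_quads_def intro: that)
  have symU: "(\<Sum>(d, e, x, y)\<in>U'. f d e x y) = (\<Sum>(d, e, x, y)\<in>U. f d e x y)"
    if "\<And>d e x y. f d e x y = f e d y x" for f :: "int \<Rightarrow> int \<Rightarrow> int \<Rightarrow> int \<Rightarrow> int"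
    by (rule sum.reindex_bij_witness[of _ "\<lambda>(d, e, x, y). (e, d, y, x)" "\<lambda>(d, e, x, y). (e, d, y, x)"])
      (auto simp: U_def U'_def factor_quads_def intro: that)
  have UX: "(\<Sum>(d, e, x, y)\<in>U. h d e x y) = (\<Sum>(d, e, x, y)\<in>X. h d (d + e) (x - y) y)"
    by (rule sum.reindex_bij_witness[of _ "\<lambda>(d, e, x, y). (d, d + e, x - y, y)"
          "\<lambda>(d, e, x, y). (d, e - d, x + y, y)"])
      (auto simp: X_def U_def factor_quads_def algebra_simps)
  have gX: "(\<Sum>(d, e, x, y)\<in>X. g d e x y) =
      (\<Sum>(d, e, x, y)\<in>X. h d e x y) - (\<Sum>(d, e, x, y)\<in>X. h d (d + e) (x - y) y)"
    unfolding sum_subtractf[symmetric]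
    by (rule sum.cong) (auto simp: X_def factor_quads_def g_eq)
  have gX0: "(\<Sum>(d, e, x, y)\<in>X0. g d e x y) =
      (\<Sum>(d, e, x, y)\<in>X0. h d e x y) - (\<Sum>(d, e, x, y)\<in>X0. h d (d + e) 0 y)"
    unfolding sum_subtractf[symmetric]
    by (rule sum.cong) (auto simp: X0_def factor_quads_def g_eq)
  have U0: "(\<Sum>(d, e, x, y)\<in>U0. h d e x y) = (\<Sum>(d, e, x, y)\<in>U0. h d d x y)"
    by (rule sum.cong) (auto simp: U0_def)
  have "(\<Sum>(d, e, x, y)\<in>factor_quads N. g d e x y) =
      2 * (\<Sum>(d, e, x, y)\<in>X. g d e x y) + (\<Sum>(d, e, x, y)\<in>X0. g d e x y)"
    using splitX[of g] symX[of g, OF g_sym] by simp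
  \<comment> \<open>The total of \<open>h\<close> is split in two ways, 2 X + X0 = 2 U + U0. With
    \<open>UX\<close> the sums over \<open>X\<close> and \<open>U\<close> disappear, and the
    \<open>h d e x y\<close> part on \<open>X0\<close> cancels.\<close>
  also have "\<dots> = (\<Sum>(d, e, x, y)\<in>U0. h d d x y) - (\<Sum>(d, e, x, y)\<in>X0. h d (d + e) 0 y)"
    using splitX[of h] splitU[of h] symX[of h, OF h_sym] symU[of h, OF h_sym] gX gX0 UX U0
    by linarith
  finally show ?thesis
    by (simp add: X0_def U0_def)
qed

lemma sum_factor_quads_diagonal_left:
  "(\<Sum>(d, e, x, y)\<in>{(d, e, x, y)\<in>factor_quads N. d = e}. f d x y) =
   (\<Sum>(d, m)\<in>factor_pairs N. \<Sum>x\<in>{0<..<m}. (f d x (m - x) :: int))"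
proof -
  have "(\<Sum>(d, m)\<in>factor_pairs N. \<Sum>x\<in>{0<..<m}. f d x (m - x)) =
      (\<Sum>p\<in>factor_pairs N. \<Sum>x\<in>{0<..<snd p}. f (fst p) x (snd p - x))"
    by (simp add: case_prod_unfold)
  also have "\<dots> = (\<Sum>(p, x)\<in>(SIGMA p:factor_pairs N. {0<..<snd p}). f (fst p) x (snd p - x))"
    by (rule sum.Sigma) auto
  also have "\<dots> = (\<Sum>(d, e, x, y)\<in>{(d, e, x, y)\<in>factor_quads N. d = e}. f d x y)"
    by (rule sum.reindex_bij_witness[of _ "\<lambda>(d, e, x, y). ((d, x + y), x)"
          "\<lambda>((d, m), x). (d, d, x, m - x)"])
      (auto simp: factor_quads_def factor_pairs_def algebra_simps)
  finally show ?thesis ..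
qed

lemma sum_factor_quads_diagonal_right:
  "(\<Sum>(d, e, x, y)\<in>{(d, e, x, y)\<in>factor_quads N. x = y}. f d e y) =
   (\<Sum>(m, y)\<in>factor_pairs N. \<Sum>d\<in>{0<..<m}. (f d (m - d) y :: int))"
proof -
  have "(\<Sum>(m, y)\<in>factor_pairs N. \<Sum>d\<in>{0<..<m}. f d (m - d) y) =
      (\<Sum>p\<in>factor_pairs N. \<Sum>d\<in>{0<..<fst p}. f d (fst p - d) (snd p))"
    by (simp add: case_prod_unfold)
  also have "\<dots> = (\<Sum>(p, d)\<in>(SIGMA p:factor_pairs N. {0<..<fst p}). f d (fst p - d) (snd p))"
    by (rule sum.Sigma) auto
  also have "\<dots> = (\<Sum>(d, e, x, y)\<in>{(d, e, x, y)\<in>factor_quads N. x = y}. f d e y)"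
    by (rule sum.reindex_bij_witness[of _ "\<lambda>(d, e, x, y). ((d + e, x), d)"
          "\<lambda>((m, y), d). (d, m - d, y, y)"])
      (auto simp: factor_quads_def factor_pairs_def algebra_simps)
  finally show ?thesis ..
qed

lemma sum_factor_quads_product:
  "(\<Sum>(d, e, x, y)\<in>factor_quads N. (F d x :: int) * G e y) =
   (\<Sum>a\<in>{0<..<N}. (\<Sum>(d, x)\<in>factor_pairs a. F d x) * (\<Sum>(e, y)\<in>factor_pairs (N - a). G e y))"
proof -
  have "(\<Sum>a\<in>{0<..<N}. (\<Sum>(d, x)\<in>factor_pairs a. F d x) * (\<Sum>(e, y)\<in>factor_pairs (N - a). G e y)) =
      (\<Sum>a\<in>{0<..<N}. \<Sum>(p, q)\<in>factor_pairs a \<times> factor_pairs (N - a). F (fst p) (snd p) * G (fst q) (snd q))"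
    by (simp add: sum_product sum.cartesian_product case_prod_unfold)
  also have "\<dots> = (\<Sum>(a, p, q)\<in>(SIGMA a:{0<..<N}. factor_pairs a \<times> factor_pairs (N - a)).
      F (fst p) (snd p) * G (fst q) (snd q))"
    by (subst sum.Sigma) (auto simp: case_prod_unfold)
  also have "\<dots> = (\<Sum>(d, e, x, y)\<in>factor_quads N. F d x * G e y)"
    by (rule sum.reindex_bij_witness[of _ "\<lambda>(d, e, x, y). (d * x, (d, x), (e, y))"
          "\<lambda>(a, (d, x), (e, y)). (d, e, x, y)"])
      (auto simp: factor_quads_def factor_pairs_def)
  finally show ?thesis ..
qed

section \<open>Weights modulo 12\<close>

definition chi3 :: "int \<Rightarrow> int" where
  "chi3 n = (if n mod 3 = 1 then 1 else if n mod 3 = 2 then - 1 else 0)"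

definition chi4 :: "int \<Rightarrow> int" where
  "chi4 n = (if n mod 4 = 1 then 1 else if n mod 4 = 3 then - 1 else 0)"

definition chi12 :: "int \<Rightarrow> int" where
  "chi12 n = chi4 n * chi3 n"

text \<open>In a factorization of an even number an odd \<open>x\<close> forces \<open>d\<close> to
  be even, where \<open>chi4\<close> vanishes; so only odd numbers receive a nonzero sum.\<close>

definition wt_d :: "int \<Rightarrow> int \<Rightarrow> int" where
  "wt_d d x = (if odd x then chi4 d else 0)"

text \<open>The condition on \<open>d\<close> selects the multiples of 3, as needed for the form 3
  (x^2 + y^2).\<close>

definition wt_d3 :: "int \<Rightarrow> int \<Rightarrow> int" where
  "wt_d3 d x = (if odd x \<and> d mod 3 = 0 then chi4 d else 0)"

definition wt_J :: "int \<Rightarrow> int \<Rightarrow> int" where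
  "wt_J e y = - 2 * chi3 e *
     (if even y then (if even e then 1 else - 1)
      else if e mod 4 = 2 then 1 else if e mod 4 = 0 then - 1 else 0)"

text \<open>A correction weight: it sums to 0 over the factorizations of any multiple of 4, so for N
  = 1 modulo 4 it changes \<open>gQ\<close> without changing its total.\<close>

definition wt_Q :: "int \<Rightarrow> int \<Rightarrow> int" where
  "wt_Q e y = chi3 e *
     (if even y then (if e mod 4 = 0 then 2 else if odd e then - 1 else 0)
      else if e mod 4 = 2 then - 4 else if e mod 4 = 0 then 1 else 0)"

definition wt_Q3 :: "int \<Rightarrow> int \<Rightarrow> int" where
  "wt_Q3 e y = chi3 e *
     (if even y then 0 else if e mod 4 = 2 then 12 else if e mod 4 = 0 then - 9 else 0)"

definition gJ :: "int \<Rightarrow> int \<Rightarrow> int \<Rightarrow> int \<Rightarrow> int" where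
  "gJ d e x y = wt_d d x * wt_J e y + wt_d e y * wt_J d x"

definition gQ :: "int \<Rightarrow> int \<Rightarrow> int \<Rightarrow> int \<Rightarrow> int" where
  "gQ d e x y = wt_d d x * wt_Q e y + wt_d3 d x * wt_Q3 e y
     + (wt_d e y * wt_Q d x + wt_d3 e y * wt_Q3 d x)"

text \<open>The potentials \<open>hJ\<close> and \<open>hQ\<close> were found by solving \<open>g(d, e, x, y) = h(d, e, x, y) - h(d, d + e, x - y, y)\<close>
  as a linear system over the residue classes of \<open>d, e\<close> modulo 12 and \<open>x, y\<close> modulo 2.
  The weights in \<open>gJ\<close> and \<open>gQ\<close> are chosen such that this system is solvable and that, for
  \<open>N \<equiv> 3\<close> respectively \<open>N \<equiv> 1\<close> modulo 4, all terms but the wanted convolution vanish or cancel.\<close>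

definition hJ1 :: "int \<Rightarrow> int \<Rightarrow> int" where
  "hJ1 d e = chi4 d * (chi3 d +
     (if even e then chi3 (d + e) + chi3 (d - e) - chi3 e
      else chi3 e - chi3 (d + e) - chi3 (d - e)))"

definition hJ2 :: "int \<Rightarrow> int \<Rightarrow> int" where
  "hJ2 d e = chi4 (d + e) *
     (chi3 d + chi3 e + chi3 (d + e) + (if odd e then chi3 (e - d) else chi3 (d - e)))"

definition hJ :: "int \<Rightarrow> int \<Rightarrow> int \<Rightarrow> int \<Rightarrow> int" where
  "hJ d e x y = (if even (d * x + e * y) then 0
     else if even y then hJ1 d e else if even x then hJ1 e d else hJ2 d e)"

definition hQ1 :: "int \<Rightarrow> int \<Rightarrow> int" where
  "hQ1 d e = chi4 d * (3 * chi3 d +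
     (if e mod 4 = 0 then chi3 e
      else if (d - e) mod 4 = 0 then chi3 (d - e)
      else if (d + e) mod 4 = 0 then chi3 (d + e) - chi3 e
      else - chi3 (d + e) - chi3 (d - e)))"

text \<open>For odd \<open>x\<close> and \<open>y\<close> exactly one of \<open>d\<close>,
  \<open>e\<close> is even. It is passed first, which keeps \<open>hQ\<close> symmetric.\<close>

definition hQ2 :: "int \<Rightarrow> int \<Rightarrow> int" where
  "hQ2 e d = - chi4 (d + e) *
     (3 * chi3 (e - d) + (if e mod 4 = 0 then chi3 e else chi3 d + chi3 (d + e)))"

definition hQ :: "int \<Rightarrow> int \<Rightarrow> int \<Rightarrow> int \<Rightarrow> int" where
  "hQ d e x y = (if even (d * x + e * y) then 0
     else if even y then hQ1 d e else if even x then hQ1 e d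
     else if even d then hQ2 d e else hQ2 e d)"

lemma chi_cong:
  assumes "a mod 12 = b mod 12"
  shows "chi3 a = chi3 b" "chi4 a = chi4 b" "a mod 4 = b mod 4" "a mod 3 = b mod 3" "even a = even b"
proof -
  have "a mod 12 mod 4 = b mod 12 mod 4" "a mod 12 mod 3 = b mod 12 mod 3"
    by (simp_all add: assms)
  then show "a mod 4 = b mod 4" "a mod 3 = b mod 3"
    by (simp_all add: mod_mod_cancel)
  then show "chi3 a = chi3 b" "chi4 a = chi4 b"
    by (simp_all add: chi3_def chi4_def)
  have "even (a mod 12) = even (b mod 12)"
    by (simp only: assms)
  then show "even a = even b"
    by (simp add: dvd_mod_iff)
qed

lemma sum_diff_mod_12:
  fixes d e :: int
  shows "(d mod 12 + e mod 12) mod 12 = (d + e) mod 12" "(d mod 12 - e mod 12) mod 12 = (d - e) mod 12"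
  by (simp_all add: mod_simps)

lemmas chi_mod_12 =
  chi_cong[OF mod_mod_trivial] chi_cong[OF sum_diff_mod_12(1)] chi_cong[OF sum_diff_mod_12(2)]

lemma even_mod_2: "even (x mod 2) = even (x :: int)"
  by simp

lemma hJ_mod: "hJ (d mod 12) (e mod 12) (x mod 2) (y mod 2) = hJ d e x y"
  by (simp only: hJ_def hJ1_def hJ2_def chi_mod_12 even_add even_mult_iff even_mod_2)

lemma hQ_mod: "hQ (d mod 12) (e mod 12) (x mod 2) (y mod 2) = hQ d e x y"
  by (simp only: hQ_def hQ1_def hQ2_def chi_mod_12 even_add even_mult_iff even_mod_2)

lemma gJ_mod: "gJ (d mod 12) (e mod 12) (x mod 2) (y mod 2) = gJ d e x y"
  by (simp only: gJ_def wt_d_def wt_J_def chi_mod_12 even_add even_mult_iff even_mod_2)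

lemma gQ_mod: "gQ (d mod 12) (e mod 12) (x mod 2) (y mod 2) = gQ d e x y"
  by (simp only: gQ_def wt_d_def wt_d3_def wt_Q_def wt_Q3_def chi_mod_12 even_add even_mult_iff even_mod_2)

text \<open>Both sides depend only on \<open>d\<close>, \<open>e\<close> modulo 12 and on the
  parities of \<open>x\<close>, \<open>y\<close>, so the difference equation is a finite check. The
  parity pattern (0, 0) is absent because it makes \<open>d * x + e * y\<close> even.\<close>

lemma gJ_table:
  "\<forall>d\<in>set [0..11]. \<forall>e\<in>set [0..11]. \<forall>(x, y)\<in>set [(1, 1), (1, 0), (0, 1)]. odd (d * x + e * y) \<longrightarrow>
     gJ d e x y = hJ d e x y - hJ d (d + e) (x - y) y"
  by code_simp

lemma gQ_table:
  "\<forall>d\<in>set [0..11]. \<forall>e\<in>set [0..11]. \<forall>(x, y)\<in>set [(1, 1), (1, 0), (0, 1)]. odd (d * x + e * y) \<longrightarrow>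
     gQ d e x y = hQ d e x y - hQ d (d + e) (x - y) y"
  by code_simp

lemma odd_residues_table:
  assumes "\<forall>d\<in>set [0..11]. \<forall>e\<in>set [0..11]. \<forall>(x, y)\<in>set [(1, 1), (1, 0), (0, 1)].
      odd (d * x + e * y) \<longrightarrow> P d e x y"
    and "odd (d * x + e * y)"
  shows "P (d mod 12) (e mod 12) (x mod 2) (y mod 2)"
proof -
  have "d mod 12 \<in> set [0..11]" "e mod 12 \<in> set [0..11]"
    by auto
  moreover have odd: "odd ((d mod 12) * (x mod 2) + (e mod 12) * (y mod 2))"
    using assms(2) by (simp add: dvd_mod_iff)
  then have "(x mod 2, y mod 2) \<in> set [(1, 1), (1, 0), (0, 1)]"
    by (auto simp: mod_2_eq_odd)
  ultimately show ?thesis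
    using assms(1) odd by blast
qed

lemma gJ_eq:
  assumes "odd (d * x + e * y)"
  shows "gJ d e x y = hJ d e x y - hJ d (d + e) (x - y) y"
proof -
  define d' e' x' y' where "d' = d mod 12" "e' = e mod 12" "x' = x mod 2" "y' = y mod 2"
  note defs = this
  have "gJ d' e' x' y' = hJ d' e' x' y' - hJ d' (d' + e') (x' - y') y'"
    unfolding defs by (rule odd_residues_table[OF gJ_table assms])
  \<comment> \<open>After one step the representatives may leave their ranges:
    \<open>d' + e'\<close> can exceed 11 and \<open>x' - y'\<close> can be -1. Both sides are
    therefore reduced once more.\<close>
  moreover have "hJ d' (d' + e') (x' - y') y' = hJ d (d + e) (x - y) y"
    unfolding hJ_mod[of d' "d' + e'" "x' - y'" y', symmetric] hJ_mod[of d "d + e" "x - y" y, symmetric]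
    by (simp add: defs mod_simps)
  ultimately show ?thesis
    by (simp add: defs hJ_mod gJ_mod)
qed

lemma gQ_eq:
  assumes "odd (d * x + e * y)"
  shows "gQ d e x y = hQ d e x y - hQ d (d + e) (x - y) y"
proof -
  define d' e' x' y' where "d' = d mod 12" "e' = e mod 12" "x' = x mod 2" "y' = y mod 2"
  note defs = this
  have "gQ d' e' x' y' = hQ d' e' x' y' - hQ d' (d' + e') (x' - y') y'"
    unfolding defs by (rule odd_residues_table[OF gQ_table assms])
  moreover have "hQ d' (d' + e') (x' - y') y' = hQ d (d + e) (x - y) y"
    unfolding hQ_mod[of d' "d' + e'" "x' - y'" y', symmetric] hQ_mod[of d "d + e" "x - y" y, symmetric]
    by (simp add: defs mod_simps)
  ultimately show ?thesis
    by (simp add: defs hQ_mod gQ_mod)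
qed

section \<open>Sums of the potentials over the two diagonals\<close>

lemma chi3_double: "chi3 (2 * d) = - chi3 d"
  unfolding chi3_def by presburger

lemma chi3_0 [simp]: "chi3 0 = 0"
  by (simp add: chi3_def)

lemma hJ1_self: "odd d \<Longrightarrow> hJ1 d d = 3 * chi12 d"
  by (simp add: hJ1_def chi12_def chi3_double)

lemma hQ1_self: "odd d \<Longrightarrow> hQ1 d d = 3 * chi12 d"
  by (auto simp: hQ1_def chi12_def chi3_def)

lemma sum_periodic_12:
  fixes f :: "int \<Rightarrow> int"
  assumes periodic: "\<And>d. f (d mod 12) = f d" and "0 \<le> r"
  shows "(\<Sum>d\<in>{0..<12 * int q + r}. f d) = int q * (\<Sum>d\<in>{0..<12}. f d) + (\<Sum>d\<in>{0..<r}. f d)"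
proof (induction q)
  case (Suc q)
  have "{0..<12 * int (Suc q) + r} = {0..<12} \<union> {12..<12 * int (Suc q) + r}"
    using \<open>0 \<le> r\<close> by auto
  then have "(\<Sum>d\<in>{0..<12 * int (Suc q) + r}. f d) =
      (\<Sum>d\<in>{0..<12}. f d) + (\<Sum>d\<in>{12..<12 * int (Suc q) + r}. f d)"
    by (simp only:) (rule sum.union_disjoint, auto)
  also have "(\<Sum>d\<in>{12..<12 * int (Suc q) + r}. f d) = (\<Sum>d\<in>{0..<12 * int q + r}. f d)"
  proof (rule sum.reindex_bij_witness[of _ "\<lambda>d. d + 12" "\<lambda>d. d - 12"])
    fix d
    show "f (d - 12) = f d"
      using periodic[of "d - 12"] periodic[of d] by (simp add: mod_simps)
  qed auto
  finally show ?case
    using Suc.IH by (simp add: algebra_simps)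
qed simp

text \<open>With \<open>m = 12 * q + r\<close>, the \<open>q\<close> full periods give
  \<open>12 * q * A r\<close> and the remainder gives \<open>r * A r + B r\<close>, together
  \<open>m * A r + B r\<close>. The tables start at \<open>d = 0\<close> to have complete periods;
  that term is removed at the end.\<close>

lemma sum_periodic_12_linear:
  fixes f :: "int \<Rightarrow> int \<Rightarrow> int"
  assumes table: "\<forall>r\<in>set [1, 3, 5, 7, 9, 11]. (\<Sum>d\<in>{0..<12}. f r d) = 12 * A r \<and>
      (\<Sum>d\<in>{0..<r}. f r d) = r * A r + B r"
    and f_mod: "\<And>m d. f (m mod 12) (d mod 12) = f m d"
    and AB_mod: "\<And>m. A (m mod 12) = A m" "\<And>m. B (m mod 12) = B m"
    and m: "odd m" "0 < m"
  shows "(\<Sum>d\<in>{0<..<m}. f m d) = m * A m + B m - f m 0"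
proof -
  define q r where "q = nat (m div 12)" "r = m mod 12"
  have mqr: "m = 12 * int q + r" "0 \<le> r"
    using m(2) by (simp_all add: q_r_def)
  have "r \<in> set [1, 3, 5, 7, 9, 11]"
    unfolding q_r_def using m(1) by simp presburger
  then have r: "(\<Sum>d\<in>{0..<12}. f r d) = 12 * A r" "(\<Sum>d\<in>{0..<r}. f r d) = r * A r + B r"
    using table by blast+
  have fr: "f m d = f r d" for d
    using f_mod[of m d] f_mod[of r d] by (simp add: q_r_def)
  have "(\<Sum>d\<in>{0..<m}. f r d) = int q * (12 * A r) + (r * A r + B r)"
    unfolding mqr(1) r[symmetric]
    by (rule sum_periodic_12) (use f_mod[of r] in \<open>simp_all add: q_r_def\<close>)
  also have "\<dots> = m * A r + B r"
    by (simp add: mqr(1) algebra_simps)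
  finally have "(\<Sum>d\<in>{0..<m}. f m d) = m * A m + B m"
    by (simp add: fr) (simp add: q_r_def AB_mod)
  moreover have "{0..<m} = insert 0 {0<..<m}"
    using m(2) by auto
  ultimately show ?thesis
    by simp
qed

lemma hJ1_mod: "hJ1 (d mod 12) (e mod 12) = hJ1 d e"
  by (simp only: hJ1_def chi_mod_12)

lemma hQ1_mod: "hQ1 (d mod 12) (e mod 12) = hQ1 d e"
  by (simp only: hQ1_def chi_mod_12)

lemma sum_hJ1_table:
  "\<forall>r\<in>set [1, 3, 5, 7, 9, 11]. (\<Sum>d\<in>{0..<12}. hJ1 r d) = 12 * chi12 r \<and>
     (\<Sum>d\<in>{0..<r}. hJ1 r d) = r * chi12 r + 2 * chi4 r"
  by code_simp

lemma sum_hQ1_table: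
  "\<forall>r\<in>set [1, 3, 5, 7, 9, 11]. (\<Sum>d\<in>{0..<12}. hQ1 r d) = 12 * (3 * chi12 r) \<and>
     (\<Sum>d\<in>{0..<r}. hQ1 r d) = r * (3 * chi12 r) + 0"
  by code_simp

lemma chi12_mod: "chi12 (m mod 12) = chi12 m"
  by (simp only: chi12_def chi_mod_12)

lemma sum_hJ1:
  assumes "odd m" "0 < m"
  shows "(\<Sum>d\<in>{0<..<m}. hJ1 m d) = m * chi12 m - 3 * chi12 m + 2 * chi4 m"
proof -
  have "(\<Sum>d\<in>{0<..<m}. hJ1 m d) = m * chi12 m + 2 * chi4 m - hJ1 m 0"
    by (rule sum_periodic_12_linear[where A = chi12 and B = "\<lambda>m. 2 * chi4 m"])
      (fact sum_hJ1_table hJ1_mod chi12_mod assms | simp add: chi_mod_12)+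
  also have "hJ1 m 0 = 3 * chi12 m"
    by (simp add: hJ1_def chi12_def)
  finally show ?thesis
    by simp
qed

lemma sum_hQ1:
  assumes "odd m" "0 < m"
  shows "(\<Sum>d\<in>{0<..<m}. hQ1 m d) = 3 * m * chi12 m - 3 * chi12 m"
proof -
  have "(\<Sum>d\<in>{0<..<m}. hQ1 m d) = m * (3 * chi12 m) + 0 - hQ1 m 0"
    by (rule sum_periodic_12_linear[where A = "\<lambda>m. 3 * chi12 m" and B = "\<lambda>m. 0"])
      (fact sum_hQ1_table hQ1_mod assms | simp add: chi12_mod)+
  also have "hQ1 m 0 = 3 * chi12 m"
    by (simp add: hQ1_def chi12_def)
  finally show ?thesis
    by simp
qed

text \<open>For \<open>d * m = N\<close> there are \<open>m - 1\<close> splittings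
  \<open>m = x + y\<close> into positive parts, and each contributes
  \<open>3 * chi12 d\<close>.\<close>

lemma sum_diagonal_left:
  assumes "odd N" and h: "\<And>d x y. odd (d * (x + y)) \<Longrightarrow> h d d x y = 3 * chi12 d"
  shows "(\<Sum>(d, e, x, y)\<in>{(d, e, x, y)\<in>factor_quads N. d = e}. h d d x y) =
    (\<Sum>(d, m)\<in>factor_pairs N. 3 * (m * chi12 d)) - (\<Sum>(d, m)\<in>factor_pairs N. 3 * chi12 d)"
proof -
  have "(\<Sum>(d, e, x, y)\<in>{(d, e, x, y)\<in>factor_quads N. d = e}. h d d x y) =
      (\<Sum>(d, m)\<in>factor_pairs N. 3 * (m * chi12 d) - 3 * chi12 d)"
    unfolding sum_factor_quads_diagonal_left[of "\<lambda>d x y. h d d x y" N]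
    using \<open>odd N\<close> by (intro sum.cong) (auto simp: factor_pairs_def h algebra_simps)
  then show ?thesis
    by (simp add: case_prod_unfold sum_subtractf)
qed

lemma sum_gJ:
  assumes "odd N"
  shows "(\<Sum>(d, e, x, y)\<in>factor_quads N. gJ d e x y) =
    3 * (\<Sum>(d, x)\<in>factor_pairs N. x * chi12 d) - (\<Sum>(d, x)\<in>factor_pairs N. d * chi12 d) - 2 * (\<Sum>(d, x)\<in>factor_pairs N. chi4 d)"
proof -
  have "(\<Sum>(d, e, x, y)\<in>factor_quads N. gJ d e x y) =
         (\<Sum>(d, e, x, y)\<in>{(d, e, x, y)\<in>factor_quads N. d = e}. hJ d d x y) -
         (\<Sum>(d, e, x, y)\<in>{(d, e, x, y)\<in>factor_quads N. x = y}. hJ d (d + e) 0 y)"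
  proof (rule sum_factor_quads_descent)
    show "hJ d e x y = hJ e d y x" for d e x y
      by (auto simp: hJ_def hJ2_def add.commute)
    show "gJ d e x y = gJ e d y x" for d e x y
      by (simp add: gJ_def)
  qed (use \<open>odd N\<close> gJ_eq in auto)
  also have "(\<Sum>(d, e, x, y)\<in>{(d, e, x, y)\<in>factor_quads N. d = e}. hJ d d x y) =
      (\<Sum>(d, x)\<in>factor_pairs N. 3 * (x * chi12 d)) - (\<Sum>(d, x)\<in>factor_pairs N. 3 * chi12 d)"
    using \<open>odd N\<close> by (rule sum_diagonal_left) (auto simp: hJ_def hJ1_self)
  also have "(\<Sum>(d, e, x, y)\<in>{(d, e, x, y)\<in>factor_quads N. x = y}. hJ d (d + e) 0 y) =
      (\<Sum>(m, y)\<in>factor_pairs N. \<Sum>d\<in>{0<..<m}. hJ d m 0 y)"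
    unfolding sum_factor_quads_diagonal_right[of "\<lambda>d e y. hJ d (d + e) 0 y" N] by simp
  also have "\<dots> = (\<Sum>(d, x)\<in>factor_pairs N. d * chi12 d - 3 * chi12 d + 2 * chi4 d)"
    using \<open>odd N\<close> by (intro sum.cong) (auto simp: factor_pairs_def hJ_def sum_hJ1)
  \<comment> \<open>The terms \<open>3 * chi12 d\<close> from the two diagonals cancel.\<close>
  finally show ?thesis
    by (simp add: case_prod_unfold sum_subtractf sum.distrib sum_distrib_left)
qed

lemma sum_gQ:
  assumes "odd N"
  shows "(\<Sum>(d, e, x, y)\<in>factor_quads N. gQ d e x y) =
    3 * (\<Sum>(d, x)\<in>factor_pairs N. x * chi12 d) - 3 * (\<Sum>(d, x)\<in>factor_pairs N. d * chi12 d)"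
proof -
  have "(\<Sum>(d, e, x, y)\<in>factor_quads N. gQ d e x y) =
         (\<Sum>(d, e, x, y)\<in>{(d, e, x, y)\<in>factor_quads N. d = e}. hQ d d x y) -
         (\<Sum>(d, e, x, y)\<in>{(d, e, x, y)\<in>factor_quads N. x = y}. hQ d (d + e) 0 y)"
  proof (rule sum_factor_quads_descent)
    show "hQ d e x y = hQ e d y x" for d e x y
      by (auto simp: hQ_def add.commute)
    show "gQ d e x y = gQ e d y x" for d e x y
      by (simp add: gQ_def)
  qed (use \<open>odd N\<close> gQ_eq in auto)
  also have "(\<Sum>(d, e, x, y)\<in>{(d, e, x, y)\<in>factor_quads N. d = e}. hQ d d x y) =
      (\<Sum>(d, x)\<in>factor_pairs N. 3 * (x * chi12 d)) - (\<Sum>(d, x)\<in>factor_pairs N. 3 * chi12 d)"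
    using \<open>odd N\<close> by (rule sum_diagonal_left) (auto simp: hQ_def hQ1_self)
  also have "(\<Sum>(d, e, x, y)\<in>{(d, e, x, y)\<in>factor_quads N. x = y}. hQ d (d + e) 0 y) =
      (\<Sum>(m, y)\<in>factor_pairs N. \<Sum>d\<in>{0<..<m}. hQ d m 0 y)"
    unfolding sum_factor_quads_diagonal_right[of "\<lambda>d e y. hQ d (d + e) 0 y" N] by simp
  also have "\<dots> = (\<Sum>(d, x)\<in>factor_pairs N. 3 * (d * chi12 d) - 3 * chi12 d)"
    using \<open>odd N\<close> by (intro sum.cong) (auto simp: factor_pairs_def hQ_def sum_hQ1)
  finally show ?thesis
    by (simp add: case_prod_unfold sum_subtractf sum.distrib sum_distrib_left)
qed

section \<open>Convolutions of divisor sums\<close>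

definition sum_chi3 :: "int \<Rightarrow> int" where
  "sum_chi3 a = (\<Sum>(d, x)\<in>factor_pairs a. chi3 d)"

definition sum_chi4 :: "int \<Rightarrow> int" where
  "sum_chi4 a = (\<Sum>(d, x)\<in>factor_pairs a. chi4 d)"

text \<open>Here \<open>a\<close> stands for \<open>(x^2 + y^2) div 2\<close> with odd
  \<open>x\<close>, \<open>y\<close>, hence \<open>a mod 4 = 1\<close>; what remains is
  \<open>z^2 + 3 * w^2 = 2 * (N - k * a)\<close>, with the halved argument because the latter is 4
  times a value of the form of discriminant -3.\<close>

definition chi_conv :: "int \<Rightarrow> int \<Rightarrow> int" where
  "chi_conv k N = (\<Sum>a\<in>{a. 0 < a \<and> k * a < N \<and> a mod 4 = 1}. sum_chi4 a * sum_chi3 ((N - k * a) div 2))"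

lemma sum_factor_pairs_dvd_left:
  assumes "0 < k"
  shows "(\<Sum>(d, x)\<in>factor_pairs (k * c). if k dvd d then f d x else 0) = (\<Sum>(d, x)\<in>factor_pairs c. (f (k * d) x :: int))"
proof -
  have "(\<Sum>(d, x)\<in>factor_pairs (k * c). if k dvd d then f d x else 0) =
      (\<Sum>p\<in>{p\<in>factor_pairs (k * c). k dvd fst p}. f (fst p) (snd p))"
    by (subst sum.inter_filter) (auto simp: case_prod_unfold)
  also have "\<dots> = (\<Sum>(d, x)\<in>factor_pairs c. f (k * d) x)"
    by (rule sum.reindex_bij_witness[of _ "\<lambda>(d, x). (k * d, x)" "\<lambda>(d, x). (d div k, x)"])
      (use assms in \<open>auto simp: factor_pairs_def zero_less_mult_iff\<close>)
  finally show ?thesis .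
qed

lemma sum_factor_pairs_dvd_right:
  assumes "0 < k"
  shows "(\<Sum>(d, x)\<in>factor_pairs (k * c). if k dvd x then f d x else 0) = (\<Sum>(d, x)\<in>factor_pairs c. (f d (k * x) :: int))"
  using sum_factor_pairs_dvd_left[OF assms, of "\<lambda>d x. f x d" c]
  by (simp only: sum_factor_pairs_swap[of "\<lambda>d x. if k dvd x then f d x else 0"] sum_factor_pairs_swap[of "\<lambda>d x. f d (k * x)"])

lemma chi4_mult: "chi4 (a * b) = chi4 a * chi4 b"
proof -
  have "chi4 ((a mod 4) * (b mod 4)) = chi4 (a mod 4) * chi4 (b mod 4)"
  proof -
    have "a mod 4 \<in> {0, 1, 2, 3}" "b mod 4 \<in> {0, 1, 2, 3}"
      by auto
    then show ?thesis
      by (auto simp: chi4_def)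
  qed
  moreover have "chi4 (a mod 4 * (b mod 4)) = chi4 (a * b)"
    by (simp only: chi4_def mod_mult_eq)
  moreover have "chi4 (c mod 4) = chi4 c" for c
    by (simp add: chi4_def)
  ultimately show ?thesis
    by simp
qed

lemma chi3_mult: "chi3 (a * b) = chi3 a * chi3 b"
proof -
  have "chi3 ((a mod 3) * (b mod 3)) = chi3 (a mod 3) * chi3 (b mod 3)"
  proof -
    have "a mod 3 \<in> {0, 1, 2}" "b mod 3 \<in> {0, 1, 2}"
      by auto
    then show ?thesis
      by (auto simp: chi3_def)
  qed
  moreover have "chi3 (a mod 3 * (b mod 3)) = chi3 (a * b)"
    by (simp only: chi3_def mod_mult_eq)
  moreover have "chi3 (c mod 3) = chi3 c" for c
    by (simp add: chi3_def)
  ultimately show ?thesis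
    by simp
qed

lemma chi4_even: "even d \<Longrightarrow> chi4 d = 0"
  unfolding chi4_def by presburger

text \<open>Complementary divisors satisfy \<open>chi4 d * chi4 x = - 1\<close>, so exchanging them
  reverses the sign of the sum.\<close>

lemma sum_chi4_eq_0:
  assumes "a mod 4 = 3"
  shows "sum_chi4 a = 0"
proof -
  have "chi4 x = - chi4 d" if "(d, x) \<in> factor_pairs a" for d x
  proof -
    have "chi4 (d * x) = - 1"
      using that assms by (simp add: factor_pairs_def chi4_def)
    then show ?thesis
      unfolding chi4_mult by (auto simp: chi4_def split: if_splits)
  qed
  then have "(\<Sum>(d, x)\<in>factor_pairs a. chi4 x) = (\<Sum>(d, x)\<in>factor_pairs a. - chi4 d)"
    by (intro sum.cong) auto
  then have "sum_chi4 a = - sum_chi4 a"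
    using sum_factor_pairs_swap[of "\<lambda>d x. chi4 d" a] by (simp add: sum_chi4_def sum_negf case_prod_unfold)
  then show ?thesis
    by simp
qed

lemma sum_wt_d: "(\<Sum>(d, x)\<in>factor_pairs a. wt_d d x) = (if odd a then sum_chi4 a else 0)"
proof (cases "odd a")
  case True
  then show ?thesis
    unfolding sum_chi4_def by (auto simp: factor_pairs_def wt_d_def intro!: sum.cong)
next
  case False
  then have "(\<Sum>(d, x)\<in>factor_pairs a. wt_d d x) = 0"
    by (intro sum.neutral) (auto simp: factor_pairs_def wt_d_def chi4_even)
  with False show ?thesis
    by simp
qed

lemma sum_wt_d3:
  "(\<Sum>(d, x)\<in>factor_pairs a. wt_d3 d x) = (if odd a \<and> a mod 3 = 0 then - sum_chi4 (a div 3) else 0)"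
proof (cases "odd a \<and> a mod 3 = 0")
  case True
  then obtain c where c: "a = 3 * c" "odd c"
    by (auto elim!: dvdE simp: mod_eq_0_iff_dvd)
  have "(\<Sum>(d, x)\<in>factor_pairs a. wt_d3 d x) = (\<Sum>(d, x)\<in>factor_pairs (3 * c). if 3 dvd d then chi4 d else 0)"
    unfolding c using c(2)
    by (intro sum.cong) (auto simp: wt_d3_def mod_eq_0_iff_dvd factor_pairs_def, metis even_mult_iff odd_numeral)
  also have "\<dots> = (\<Sum>(d, x)\<in>factor_pairs c. - chi4 d)"
    by (subst sum_factor_pairs_dvd_left) (auto simp: chi4_mult intro!: sum.cong, simp add: chi4_def)
  finally show ?thesis
    using True by (simp add: c sum_chi4_def case_prod_unfold sum_negf)
next
  case False
  then have "(\<Sum>(d, x)\<in>factor_pairs a. wt_d3 d x) = 0"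
    by (intro sum.neutral) (auto simp: factor_pairs_def wt_d3_def chi4_even mod_eq_0_iff_dvd)
  with False show ?thesis
    by auto
qed

lemma factor_pairs_double_odd:
  assumes "odd c" "(e, y) \<in> factor_pairs (2 * c)"
  shows "odd e \<and> even y \<or> even e \<and> e mod 4 = 2 \<and> odd y"
proof -
  have ey: "e * y = 2 * c"
    using assms(2) by (simp add: factor_pairs_def)
  then have "even (e * y)"
    by simp
  moreover have "\<not> (even e \<and> even y)"
    using assms(1) ey by (auto elim!: evenE)
  moreover have "e mod 4 \<noteq> 0"
  proof
    assume "e mod 4 = 0"
    then obtain k where "e = 4 * k"
      by (auto simp: mod_eq_0_iff_dvd elim: dvdE)
    then have "c = 2 * (k * y)"
      using ey by (simp add: mult_ac)
    with assms(1) show False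
      by simp
  qed
  moreover have "e mod 4 = 2" if "e mod 4 \<noteq> 0" "even e"
    using that by presburger
  ultimately show ?thesis
    by auto
qed

text \<open>The factorizations with even \<open>y\<close> contribute \<open>2 * chi3 e\<close>;
  those with even \<open>e\<close> contribute \<open>- 2 * chi3 (2 * e)\<close> after halving
  \<open>e\<close>, which is the same amount.\<close>

lemma sum_wt_J:
  assumes "odd c"
  shows "(\<Sum>(e, y)\<in>factor_pairs (2 * c). wt_J e y) = 4 * sum_chi3 c"
proof -
  have "wt_J e y = (if 2 dvd y then 2 * chi3 e else 0) + (if 2 dvd e then - 2 * chi3 e else 0)"
    if "(e, y) \<in> factor_pairs (2 * c)" for e y
    using factor_pairs_double_odd[OF assms that] by (auto simp: wt_J_def)
  then have "(\<Sum>(e, y)\<in>factor_pairs (2 * c). wt_J e y) = (\<Sum>(e, y)\<in>factor_pairs (2 * c).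
      (if 2 dvd y then 2 * chi3 e else 0) + (if 2 dvd e then - 2 * chi3 e else 0))"
    by (intro sum.cong) auto
  also have "\<dots> = (\<Sum>(e, y)\<in>factor_pairs c. 2 * chi3 e) + (\<Sum>(e, y)\<in>factor_pairs c. - 2 * chi3 (2 * e))"
    using sum_factor_pairs_dvd_right[of 2 "\<lambda>e y. 2 * chi3 e" c] sum_factor_pairs_dvd_left[of 2 "\<lambda>e y. - 2 * chi3 e" c]
    by (simp add: case_prod_unfold sum.distrib)
  finally show ?thesis
    by (simp add: sum_chi3_def case_prod_unfold chi3_double sum_distrib_left sum.distrib[symmetric])
qed

lemma sum_wt_Q3:
  assumes "odd c"
  shows "(\<Sum>(e, y)\<in>factor_pairs (2 * c). wt_Q3 e y) = - 12 * sum_chi3 c"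
proof -
  have "wt_Q3 e y = (if 2 dvd e then 12 * chi3 e else 0)"
    if "(e, y) \<in> factor_pairs (2 * c)" for e y
    using factor_pairs_double_odd[OF assms that] by (auto simp: wt_Q3_def)
  then have "(\<Sum>(e, y)\<in>factor_pairs (2 * c). wt_Q3 e y) = (\<Sum>(e, y)\<in>factor_pairs (2 * c). if 2 dvd e then 12 * chi3 e else 0)"
    by (intro sum.cong) auto
  also have "\<dots> = (\<Sum>(e, y)\<in>factor_pairs c. 12 * chi3 (2 * e))"
    by (rule sum_factor_pairs_dvd_left) simp
  finally show ?thesis
    by (simp add: sum_chi3_def case_prod_unfold chi3_double sum_distrib_left sum_negf)
qed

text \<open>Removing the factor 4 leaves factorizations of \<open>c\<close>, and
  \<open>chi3 (4 * e) = chi3 e\<close> reduces the sum to the terms with \<open>y\<close> even plus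
  those with \<open>e\<close> even. For \<open>c = 2 * k\<close> these cancel by
  \<open>chi3 (2 * e) = - chi3 e\<close>; for odd \<open>c\<close> there are none.\<close>

lemma sum_wt_Q: "(\<Sum>(e, y)\<in>factor_pairs (4 * c). wt_Q e y) = 0"
proof -
  have wt: "wt_Q e y = (if 4 dvd e then chi3 e + (if 2 dvd y then chi3 e else 0) else 0) -
      (if 4 dvd y then (if odd e then chi3 e else 0) else 0)" if "(e, y) \<in> factor_pairs (4 * c)" for e y
  proof -
    have ey: "4 dvd e * y"
      using that by (simp add: factor_pairs_def)
    have "4 dvd y" if "odd e"
    proof -
      have "coprime (2 ^ 2) e"
        using that by (simp only: coprime_power_left_iff coprime_left_2_iff_odd) simp
      with ey show ?thesis
        by (simp add: coprime_dvd_mult_right_iff)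
    qed
    moreover have "even y" if "even e" "\<not> 4 dvd e"
    proof (rule ccontr)
      assume "odd y"
      then have "coprime (2 ^ 2) y"
        by (simp only: coprime_power_left_iff coprime_left_2_iff_odd) simp
      with ey that show False
        by (simp add: coprime_dvd_mult_left_iff)
    qed
    moreover have "even y" if "4 dvd y"
      using that by presburger
    moreover have "even e" if "4 dvd e"
      using that by presburger
    moreover have "e mod 4 = 0 \<longleftrightarrow> 4 dvd e"
      by presburger
    ultimately show ?thesis
      by (auto simp: wt_Q_def)
  qed
  have "(\<Sum>(e, y)\<in>factor_pairs (4 * c). wt_Q e y) =
      (\<Sum>(e, y)\<in>factor_pairs (4 * c). if 4 dvd e then chi3 e + (if 2 dvd y then chi3 e else 0) else 0) -
      (\<Sum>(e, y)\<in>factor_pairs (4 * c). if 4 dvd y then (if odd e then chi3 e else 0) else 0)"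
    unfolding sum_subtractf[symmetric] by (intro sum.cong) (auto simp: wt)
  also have "\<dots> = (\<Sum>(e, y)\<in>factor_pairs c. chi3 (4 * e) + (if 2 dvd y then chi3 (4 * e) else 0)) -
      (\<Sum>(e, y)\<in>factor_pairs c. if odd e then chi3 e else 0)"
    using sum_factor_pairs_dvd_left[of 4 "\<lambda>e y. chi3 e + (if 2 dvd y then chi3 e else 0)" c]
      sum_factor_pairs_dvd_right[of 4 "\<lambda>e y. if odd e then chi3 e else 0" c]
    by simp
  also have "\<dots> = (\<Sum>(e, y)\<in>factor_pairs c. if 2 dvd y then chi3 e else 0) +
      (\<Sum>(e, y)\<in>factor_pairs c. if 2 dvd e then chi3 e else 0)"
    unfolding sum_subtractf[symmetric] sum.distrib[symmetric]
    by (intro sum.cong) (auto simp: chi3_mult, simp_all add: chi3_def)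
  also have "\<dots> = 0"
  proof (cases "even c")
    case True
    then obtain k where c: "c = 2 * k"
      by (auto elim: evenE)
    show ?thesis
      unfolding c sum_factor_pairs_dvd_left[of 2 "\<lambda>e y. chi3 e" k, simplified]
        sum_factor_pairs_dvd_right[of 2 "\<lambda>e y. chi3 e" k, simplified]
      by (simp add: chi3_double case_prod_unfold sum_negf)
  next
    case False
    then have "(\<Sum>(e, y)\<in>factor_pairs c. if 2 dvd y then chi3 e else 0) = 0"
      "(\<Sum>(e, y)\<in>factor_pairs c. if 2 dvd e then chi3 e else 0) = 0"
      by (auto simp: factor_pairs_def intro!: sum.neutral)
    then show ?thesis
      by simp
  qed
  finally show ?thesis .
qed

lemma sum_factor_quads_swap:
  "(\<Sum>(d, e, x, y)\<in>factor_quads N. f e d y x) = (\<Sum>(d, e, x, y)\<in>factor_quads N. (f d e x y :: int))"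
  by (rule sum.reindex_bij_witness[of _ "\<lambda>(d, e, x, y). (e, d, y, x)" "\<lambda>(d, e, x, y). (e, d, y, x)"])
    (auto simp: factor_quads_def)

lemma chi_conv_1:
  assumes "N mod 4 = 3"
  shows "8 * chi_conv 1 N = 3 * (\<Sum>(d, x)\<in>factor_pairs N. x * chi12 d) - (\<Sum>(d, x)\<in>factor_pairs N. d * chi12 d)"
proof -
  have "odd N"
    using assms by presburger
  have "(\<Sum>(d, e, x, y)\<in>factor_quads N. gJ d e x y) =
      2 * (\<Sum>(d, e, x, y)\<in>factor_quads N. wt_d d x * wt_J e y)"
    using sum_factor_quads_swap[of "\<lambda>d e x y. wt_d d x * wt_J e y" N]
    by (simp add: gJ_def case_prod_unfold sum.distrib)
  also have "(\<Sum>(d, e, x, y)\<in>factor_quads N. wt_d d x * wt_J e y) =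
      (\<Sum>a\<in>{0<..<N}. (if odd a then sum_chi4 a else 0) * (\<Sum>(e, y)\<in>factor_pairs (N - a). wt_J e y))"
    unfolding sum_factor_quads_product sum_wt_d ..
  also have "\<dots> = (\<Sum>a\<in>{0<..<N}. if a mod 4 = 1 then sum_chi4 a * (4 * sum_chi3 ((N - a) div 2)) else 0)"
  \<comment> \<open>If \<open>a\<close> is 1 modulo 4, then \<open>N - a\<close> is twice an odd
    number, as \<open>sum_wt_J\<close> requires; if \<open>a\<close> is 3 modulo 4, the first factor
    vanishes.\<close>
  proof (rule sum.cong)
    fix a
    have "(\<Sum>(e, y)\<in>factor_pairs (N - a). wt_J e y) = 4 * sum_chi3 ((N - a) div 2)" if "a mod 4 = 1"
    proof -
      have "N - a = 2 * ((N - a) div 2)" "odd ((N - a) div 2)"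
        using that assms by presburger+
      then show ?thesis
        using sum_wt_J by metis
    qed
    moreover have "a mod 4 = 3" "sum_chi4 a = 0" if "odd a" "a mod 4 \<noteq> 1"
    proof -
      show "a mod 4 = 3"
        using that by presburger
      then show "sum_chi4 a = 0"
        by (rule sum_chi4_eq_0)
    qed
    moreover have "odd a" if "a mod 4 = 1"
      using that by presburger
    ultimately show "(if odd a then sum_chi4 a else 0) * (\<Sum>(e, y)\<in>factor_pairs (N - a). wt_J e y) =
        (if a mod 4 = 1 then sum_chi4 a * (4 * sum_chi3 ((N - a) div 2)) else 0)"
      by auto
  qed simp
  also have "\<dots> = (\<Sum>a\<in>{a\<in>{0<..<N}. a mod 4 = 1}. sum_chi4 a * (4 * sum_chi3 ((N - a) div 2)))"
    by (rule sum.inter_filter[symmetric]) simp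
  also have "\<dots> = 4 * chi_conv 1 N"
    by (simp add: chi_conv_def sum_distrib_left mult_ac)
  \<comment> \<open>The leftover term with \<open>chi4\<close> in \<open>sum_gJ\<close> vanishes
    because N is 3 modulo 4.\<close>
  finally show ?thesis
    using sum_gJ[OF \<open>odd N\<close>] sum_chi4_eq_0[OF assms] by (simp add: sum_chi4_def)
qed

text \<open>The residue classes separate the two products in \<open>gQ\<close>. For \<open>a\<close>
  = 1 modulo 4, \<open>N - a\<close> is a multiple of 4 and the \<open>wt_Q\<close> part vanishes;
  for \<open>a = 3 * b\<close> with \<open>b\<close> = 1 modulo 4, \<open>N - a\<close> is twice an
  odd number and \<open>wt_Q3\<close> gives the wanted term. The signs of \<open>sum_wt_d3\<close>
  and \<open>sum_wt_Q3\<close> cancel.\<close>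

lemma chi_conv_3:
  assumes "N mod 4 = 1"
  shows "8 * chi_conv 3 N = (\<Sum>(d, x)\<in>factor_pairs N. x * chi12 d) - (\<Sum>(d, x)\<in>factor_pairs N. d * chi12 d)"
proof -
  have "odd N"
    using assms by presburger
  have "(\<Sum>(d, e, x, y)\<in>factor_quads N. gQ d e x y) =
      2 * ((\<Sum>(d, e, x, y)\<in>factor_quads N. wt_d d x * wt_Q e y) + (\<Sum>(d, e, x, y)\<in>factor_quads N. wt_d3 d x * wt_Q3 e y))"
    using sum_factor_quads_swap[of "\<lambda>d e x y. wt_d d x * wt_Q e y" N]
      sum_factor_quads_swap[of "\<lambda>d e x y. wt_d3 d x * wt_Q3 e y" N]
    by (simp add: gQ_def case_prod_unfold sum.distrib)
  also have "(\<Sum>(d, e, x, y)\<in>factor_quads N. wt_d d x * wt_Q e y) = 0"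
    unfolding sum_factor_quads_product sum_wt_d
  proof (rule sum.neutral, rule ballI)
    fix a
    have "(\<Sum>(e, y)\<in>factor_pairs (N - a). wt_Q e y) = 0" if "a mod 4 = 1"
    proof -
      have "N - a = 4 * ((N - a) div 4)"
        using that assms by presburger
      then show ?thesis
        using sum_wt_Q by metis
    qed
    moreover have "sum_chi4 a = 0" if "odd a" "a mod 4 \<noteq> 1"
    proof -
      have "a mod 4 = 3"
        using that by presburger
      then show "sum_chi4 a = 0"
        by (rule sum_chi4_eq_0)
    qed
    ultimately show "(if odd a then sum_chi4 a else 0) * (\<Sum>(e, y)\<in>factor_pairs (N - a). wt_Q e y) = 0"
      by auto
  qed
  also have "(\<Sum>(d, e, x, y)\<in>factor_quads N. wt_d3 d x * wt_Q3 e y) =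
      (\<Sum>a\<in>{0<..<N}. (if odd a \<and> a mod 3 = 0 then - sum_chi4 (a div 3) else 0) * (\<Sum>(e, y)\<in>factor_pairs (N - a). wt_Q3 e y))"
    unfolding sum_factor_quads_product sum_wt_d3 ..
  also have "\<dots> = (\<Sum>a\<in>{0<..<N}. if a mod 3 = 0 \<and> (a div 3) mod 4 = 1
      then 12 * (sum_chi4 (a div 3) * sum_chi3 ((N - a) div 2)) else 0)"
  proof (rule sum.cong)
    fix a
    have "(\<Sum>(e, y)\<in>factor_pairs (N - a). wt_Q3 e y) = - 12 * sum_chi3 ((N - a) div 2)" if "a mod 3 = 0" "(a div 3) mod 4 = 1"
    proof -
      have "N - a = 2 * ((N - a) div 2)" "odd ((N - a) div 2)"
        using that assms by presburger+
      then show ?thesis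
        using sum_wt_Q3 by metis
    qed
    moreover have "sum_chi4 (a div 3) = 0" if "odd a" "a mod 3 = 0" "(a div 3) mod 4 \<noteq> 1"
    proof -
      have "(a div 3) mod 4 = 3"
        using that by presburger
      then show "sum_chi4 (a div 3) = 0"
        by (rule sum_chi4_eq_0)
    qed
    moreover have "odd a" if "a mod 3 = 0" "(a div 3) mod 4 = 1"
      using that by presburger
    ultimately show "(if odd a \<and> a mod 3 = 0 then - sum_chi4 (a div 3) else 0) * (\<Sum>(e, y)\<in>factor_pairs (N - a). wt_Q3 e y) =
        (if a mod 3 = 0 \<and> (a div 3) mod 4 = 1 then 12 * (sum_chi4 (a div 3) * sum_chi3 ((N - a) div 2)) else 0)"
      by auto
  qed simp
  also have "\<dots> = (\<Sum>a\<in>{a\<in>{0<..<N}. a mod 3 = 0 \<and> (a div 3) mod 4 = 1}. 12 * (sum_chi4 (a div 3) * sum_chi3 ((N - a) div 2)))"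
    by (rule sum.inter_filter[symmetric]) simp
  also have "\<dots> = (\<Sum>a\<in>{a. 0 < a \<and> 3 * a < N \<and> a mod 4 = 1}. 12 * (sum_chi4 a * sum_chi3 ((N - 3 * a) div 2)))"
    by (rule sum.reindex_bij_witness[of _ "\<lambda>a. 3 * a" "\<lambda>a. a div 3"]) auto
  also have "\<dots> = 12 * chi_conv 3 N"
    by (simp add: chi_conv_def sum_distrib_left)
  finally show ?thesis
    using sum_gQ[OF \<open>odd N\<close>] by simp
qed

section \<open>Binary forms of discriminant -4 and -3\<close>

text \<open>The norm of \<open>x + y * w\<close> where \<open>w^2 = c * w - 1\<close>: Gaussian
  integers for \<open>c = 0\<close>, Eisenstein integers for \<open>c = 1\<close>, treated
  together.\<close>

definition qf :: "int \<Rightarrow> int \<Rightarrow> int \<Rightarrow> int" where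
  "qf c x y = x\<^sup>2 + c * x * y + y\<^sup>2"

definition chi :: "int \<Rightarrow> int \<Rightarrow> int" where
  "chi c n = (if c = 0 then chi4 n else chi3 n)"

section \<open>Splitting of primes and Thue's argument\<close>

lemma element_of_order:
  fixes p m :: nat
  assumes "prime p" "m dvd p - 1" "1 < m"
  shows "\<exists>r. [r ^ m = 1] (mod p) \<and> (\<forall>k. 0 < k \<and> k < m \<longrightarrow> \<not> [r ^ k = 1] (mod p))"
proof -
  obtain g where "residue_primroot p g"
    using prime_primitive_root_exists[OF prime_gt_1_nat] assms(1) by blast
  then have ord: "ord p g = p - 1"
    using assms(1) by (simp add: residue_primroot_def totient_prime)
  define l where "l = (p - 1) div m"
  have l: "l * m = p - 1"
    using assms by (simp add: l_def)
  then have "0 < l"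
    using prime_gt_1_nat[OF assms(1)] by (cases "l = 0") auto
  show ?thesis
  proof (intro exI[of _ "g ^ l"] conjI allI impI)
    show "[(g ^ l) ^ m = 1] (mod p)"
      by (simp only: power_mult[symmetric] l ord[symmetric] Pocklington.ord)
    fix k assume k: "0 < k \<and> k < m"
    then have "l * k < l * m"
      using \<open>0 < l\<close> by simp
    then show "\<not> [(g ^ l) ^ k = 1] (mod p)"
      using ord_minimal[of "l * k" p g] k l ord \<open>0 < l\<close> by (simp add: power_mult)
  qed
qed

text \<open>An element of order 4 (for \<open>c = 0\<close>) or 3 (for \<open>c = 1\<close>) modulo
  \<open>p\<close> is such a root, and it exists because the order divides
  \<open>p - 1\<close>.\<close>

lemma split_root:
  fixes p :: nat
  assumes p: "prime p" and c: "c = 0 \<or> c = 1" and chi: "chi c (int p) = 1"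
  shows "\<exists>r. int p dvd r\<^sup>2 + c * r + 1"
proof -
  have pi: "prime (int p)"
    using p by simp
  show ?thesis
    using c
  proof
    assume "c = 0"
    then have "int p mod 4 = 1"
      using chi by (auto simp: chi_def chi4_def split: if_splits)
    then have "4 dvd p - 1"
      by presburger
    then obtain r where r: "[r ^ 4 = 1] (mod p)" "\<not> [r ^ 2 = 1] (mod p)"
      using element_of_order[OF p, of 4] by auto
    have "int p dvd int r ^ 4 - 1"
      using r(1) by (metis cong_iff_dvd_diff cong_int_iff of_nat_1 of_nat_power)
    also have "int r ^ 4 - 1 = (int r ^ 2 - 1) * (int r ^ 2 + 1)"
      by (simp add: algebra_simps power2_eq_square power3_eq_cube power4_eq_xxxx)
    finally have "int p dvd int r ^ 2 - 1 \<or> int p dvd int r ^ 2 + 1"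
      using pi prime_dvd_mult_iff by blast
    moreover have "\<not> int p dvd int r ^ 2 - 1"
      using r(2) by (metis cong_iff_dvd_diff cong_int_iff of_nat_1 of_nat_power)
    ultimately show ?thesis
      using \<open>c = 0\<close> by auto
  next
    assume "c = 1"
    then have "int p mod 3 = 1"
      using chi by (auto simp: chi_def chi3_def split: if_splits)
    then have "3 dvd p - 1"
      by presburger
    then obtain r where r: "[r ^ 3 = 1] (mod p)" "\<not> [r ^ 1 = 1] (mod p)"
      using element_of_order[OF p, of 3] by auto
    have "int p dvd int r ^ 3 - 1"
      using r(1) by (metis cong_iff_dvd_diff cong_int_iff of_nat_1 of_nat_power)
    also have "int r ^ 3 - 1 = (int r - 1) * (int r ^ 2 + int r + 1)"
      by (simp add: algebra_simps power2_eq_square power3_eq_cube power4_eq_xxxx)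
    finally have "int p dvd int r - 1 \<or> int p dvd int r ^ 2 + int r + 1"
      using pi prime_dvd_mult_iff by blast
    moreover have "\<not> int p dvd int r - 1"
      using r(2) by (metis cong_iff_dvd_diff cong_int_iff of_nat_1 power_one_right)
    ultimately show ?thesis
      using \<open>c = 1\<close> by auto
  qed
qed

text \<open>A root has order 4 for \<open>c = 0\<close>, and order 1 or 3 for \<open>c = 1\<close>.
  By Fermat the order divides \<open>p - 1\<close>, which puts \<open>p\<close> in the class 1
  modulo 4 or 3; order 1 means a root congruent to 1 and so \<open>p = 3\<close>, where
  \<open>chi3\<close> is 0.\<close>

lemma root_not_inert:
  fixes p :: nat
  assumes p: "prime p" "odd p" and c: "c = 0 \<or> c = 1" and dvd: "int p dvd r\<^sup>2 + c * r + 1"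
  shows "chi c (int p) \<noteq> - 1"
proof
  assume chi: "chi c (int p) = - 1"
  define R where "R = nat (r mod int p)"
  have R: "[int R = r] (mod int p)"
    using prime_gt_0_nat[OF p(1)] by (simp add: R_def)
  have cong: "[R ^ k = 1] (mod p) \<longleftrightarrow> int p dvd r ^ k - 1" for k
  proof -
    have "[R ^ k = 1] (mod p) \<longleftrightarrow> [int R ^ k = 1] (mod int p)"
      by (metis cong_int_iff of_nat_1 of_nat_power)
    also have "\<dots> \<longleftrightarrow> [r ^ k = 1] (mod int p)"
      using cong_pow[OF R, of k] cong_trans cong_sym by blast
    finally show ?thesis
      by (simp add: cong_iff_dvd_diff)
  qed
  have ord_dvd: "ord p R dvd p - 1" if "\<not> int p dvd r"
  proof -
    have "\<not> p dvd R"
      using that R by (metis cong_dvd_iff int_dvd_int_iff cong_sym)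
    then show ?thesis
      using fermat_theorem[OF p(1)] ord_divides by blast
  qed
  have "\<not> int p dvd r"
  proof
    assume "int p dvd r"
    then have "int p dvd r * (r + c)"
      by simp
    then have "int p dvd (r\<^sup>2 + c * r + 1) - r * (r + c)"
      using dvd by (rule dvd_diff[rotated])
    also have "(r\<^sup>2 + c * r + 1) - r * (r + c) = 1"
      by (simp add: algebra_simps power2_eq_square power3_eq_cube power4_eq_xxxx)
    finally show False
      using prime_gt_1_nat[OF p(1)] by simp
  qed
  note ord_dvd = ord_dvd[OF this]
  show False
    using c
  proof
    assume "c = 0"
    have "int p dvd (r\<^sup>2 + 1) * (r\<^sup>2 - 1)"
      using dvd \<open>c = 0\<close> by simp
    also have "(r\<^sup>2 + 1) * (r\<^sup>2 - 1) = r ^ 4 - 1"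
      by (simp add: algebra_simps power2_eq_square power3_eq_cube power4_eq_xxxx)
    finally have "ord p R dvd 2 ^ 2"
      using cong ord_divides by simp
    moreover have "\<not> ord p R dvd 2"
    proof
      assume "ord p R dvd 2"
      then have "int p dvd r ^ 2 - 1"
        using cong ord_divides by blast
      then have "int p dvd (r\<^sup>2 + 1) - (r ^ 2 - 1)"
        using dvd \<open>c = 0\<close> by (intro dvd_diff[of _ "r\<^sup>2 + 1"]) simp_all
      then have "int p dvd int 2"
        by simp
      then have "p dvd 2"
        by (simp only: int_dvd_int_iff)
      then show False
        using p primes_dvd_imp_eq two_is_prime_nat by blast
    qed
    ultimately have "ord p R = 4"
      using divides_primepow_nat[OF two_is_prime_nat, of "ord p R" 2]
      by (auto simp: le_Suc_eq numeral_2_eq_2)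
    then have "4 dvd p - 1"
      using ord_dvd by simp
    then have "int p mod 4 = 1"
      using prime_gt_1_nat[OF p(1)] by presburger
    with chi \<open>c = 0\<close> show False
      by (simp add: chi_def chi4_def)
  next
    assume "c = 1"
    have "int p dvd (r\<^sup>2 + r + 1) * (r - 1)"
      using dvd \<open>c = 1\<close> by simp
    also have "(r\<^sup>2 + r + 1) * (r - 1) = r ^ 3 - 1"
      by (simp add: algebra_simps power2_eq_square power3_eq_cube power4_eq_xxxx)
    finally have "ord p R dvd 3"
      using cong ord_divides by simp
    then have "ord p R = 1 \<or> ord p R = 3"
      using prime_nat_iff[of 3] by simp
    moreover have "ord p R \<noteq> 3"
    proof
      assume "ord p R = 3"
      then have "int p mod 3 = 1"
        using ord_dvd prime_gt_1_nat[OF p(1)] by simp presburger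
      with chi \<open>c = 1\<close> show False
        by (simp add: chi_def chi3_def)
    qed
    ultimately have "int p dvd r ^ 1 - 1"
      using cong[of 1] ord_divides[of R 1 p] by simp
    then have "int p dvd (r - 1) * (r + 2)"
      by simp
    then have "int p dvd (r\<^sup>2 + r + 1) - (r - 1) * (r + 2)"
      using dvd \<open>c = 1\<close> by (intro dvd_diff) simp_all
    also have "(r\<^sup>2 + r + 1) - (r - 1) * (r + 2) = int 3"
      by (simp add: algebra_simps power2_eq_square)
    finally have "p dvd 3"
      by (simp only: int_dvd_int_iff)
    then have "p = 3"
      using p primes_dvd_imp_eq[of p 3] by simp
    with chi \<open>c = 1\<close> show False
      by (simp add: chi_def chi3_def)
  qed
qed

text \<open>Thue's argument: there are \<open>(s + 1)^2 > p\<close> pairs in the box, so two of them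
  agree in \<open>r * u - v\<close> modulo \<open>p\<close>. Their difference is a short vector on
  which the form is a positive multiple of \<open>p\<close>, below \<open>2 * p\<close> or
  \<open>3 * p\<close>.\<close>

lemma split_prime_represented:
  fixes p :: nat
  assumes p: "prime p" "odd p" and c: "c = 0 \<or> c = 1" and chi: "chi c (int p) = 1"
  shows "\<exists>a b. qf c a b = int p"
proof -
  obtain r where r: "int p dvd r\<^sup>2 + c * r + 1"
    using split_root[OF p(1) c chi] by blast
  define s where "s = floor_sqrt p"
  define f where "f = (\<lambda>(u, v). (r * u - v) mod int p)"
  have "f ` ({0..int s} \<times> {0..int s}) \<subseteq> {0..<int p}"
    using prime_gt_0_nat[OF p(1)] by (auto simp: f_def)
  then have "card (f ` ({0..int s} \<times> {0..int s})) \<le> p"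
    using card_mono[of "{0..<int p}"] by simp
  also have "p < card ({0..int s} \<times> {0..int s})"
    using Suc_floor_sqrt_power2_gt[of p] by (simp add: s_def card_cartesian_product power2_eq_square nat_add_distrib)
  finally have "\<not> inj_on f ({0..int s} \<times> {0..int s})"
    by (rule pigeonhole)
  then obtain w w' where w: "w \<in> {0..int s} \<times> {0..int s}" "w' \<in> {0..int s} \<times> {0..int s}" "f w = f w'" "w \<noteq> w'"
    unfolding inj_on_def by blast
  obtain u v where "w = (u, v)"
    by (cases w)
  moreover obtain u' v' where "w' = (u', v')"
    by (cases w')
  ultimately have uv: "(u, v) \<noteq> (u', v')" "f (u, v) = f (u', v')"
    "0 \<le> u" "u \<le> s" "0 \<le> v" "v \<le> s" "0 \<le> u'" "u' \<le> s" "0 \<le> v'" "v' \<le> s"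
    using w by simp_all
  define x y where "x = u - u'" "y = v - v'"
  note xy = this
  have ne: "x \<noteq> 0 \<or> y \<noteq> 0"
    using uv by (auto simp: xy)
  have "int p dvd r * x - y"
  proof -
    have "int p dvd (r * u - v) - (r * u' - v')"
      using uv(2) by (simp add: f_def mod_eq_dvd_iff)
    then show ?thesis
      by (simp add: xy algebra_simps)
  qed
  then have "int p dvd (r\<^sup>2 + c * r + 1) * x\<^sup>2 - (r * x - y) * (c * x + y + r * x)"
    using r by (intro dvd_diff) simp_all
  also have "(r\<^sup>2 + c * r + 1) * x\<^sup>2 - (r * x - y) * (c * x + y + r * x) = qf c x y"
    by (simp add: qf_def algebra_simps power2_eq_square)
  finally obtain k where k: "qf c x y = int p * k"
    by (auto elim: dvdE)
  have "s\<^sup>2 \<noteq> p"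
    using p(1) by (auto simp: prime_power_iff)
  then have "s\<^sup>2 < p"
    unfolding s_def by (rule le_neq_implies_less[OF floor_sqrt_power2_le])
  then have s: "(int s)\<^sup>2 < int p"
    by (metis of_nat_less_iff of_nat_power)
  have "\<bar>x\<bar> \<le> int s" "\<bar>y\<bar> \<le> int s"
    using uv by (auto simp: xy)
  then have "x\<^sup>2 \<le> (int s)\<^sup>2" "y\<^sup>2 \<le> (int s)\<^sup>2" "\<bar>x * y\<bar> \<le> (int s)\<^sup>2"
    using abs_le_square_iff[of x "int s"] abs_le_square_iff[of y "int s"]
      mult_mono[of "\<bar>x\<bar>" "int s" "\<bar>y\<bar>" "int s"] by (simp_all add: abs_mult power2_eq_square)
  with s have bounds: "x\<^sup>2 < int p" "y\<^sup>2 < int p" "x * y < int p"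
    by linarith+
  have pos: "0 < qf c x y"
  proof -
    have "0 < x\<^sup>2 + y\<^sup>2"
      using ne by (simp add: sum_power2_gt_zero_iff)
    moreover have "0 \<le> (x + y)\<^sup>2"
      by simp
    ultimately have "0 < 2 * qf c x y"
      using c by (auto simp: qf_def power2_eq_square algebra_simps)
    then show ?thesis
      by simp
  qed
  have "0 < k"
    using pos k by (simp add: zero_less_mult_iff)
  show ?thesis
    using c
  proof
    assume "c = 0"
    then have "int p * k < int p * 2"
      using k bounds by (simp add: qf_def)
    then have "k < 2"
      using mult_less_cancel_left_pos[of "int p" k 2] prime_gt_0_nat[OF p(1)] by simp
    with \<open>0 < k\<close> have "k = 1"
      by simp
    with k show ?thesis
      by auto
  next
    assume "c = 1"
    then have "int p * k < int p * 3"
      using k bounds by (simp add: qf_def)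
    then have "k < 3"
      using mult_less_cancel_left_pos[of "int p" k 3] prime_gt_0_nat[OF p(1)] by simp
    \<comment> \<open>\<open>x^2 + x * y + y^2\<close> is even only if \<open>x\<close> and
      \<open>y\<close> both are; it is then divisible by 4, and \<open>p\<close> would be
      even.\<close>
    moreover have "k \<noteq> 2"
    proof
      assume "k = 2"
      then have "even (qf c x y)"
        using k by simp
      then have "even x" "even y"
        using \<open>c = 1\<close> by (auto simp: qf_def)
      then obtain x' y' where "x = 2 * x'" "y = 2 * y'"
        by (auto elim!: evenE)
      then have "int p = 2 * qf c x' y'"
        using k \<open>k = 2\<close> by (simp add: qf_def power2_eq_square algebra_simps)
      then show False
        using p(2) by (metis even_mult_iff even_numeral even_of_nat)
    qed
    ultimately have "k = 1"
      using \<open>0 < k\<close> by simp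
    with k show ?thesis
      by auto
  qed
qed

text \<open>If \<open>y\<close> were invertible modulo \<open>p\<close>, the quotient of
  \<open>x\<close> by \<open>y\<close> would be a root of \<open>r^2 + c * r + 1\<close>.\<close>

lemma inert_dvd:
  fixes p :: nat
  assumes p: "prime p" "odd p" and c: "c = 0 \<or> c = 1" and chi: "chi c (int p) = - 1"
    and dvd: "int p dvd qf c x y"
  shows "int p dvd x \<and> int p dvd y"
proof -
  have pi: "prime (int p)"
    using p by simp
  have "int p dvd y"
  proof (rule ccontr)
    assume "\<not> int p dvd y"
    then have "coprime y (int p)"
      using pi by (metis coprime_commute prime_imp_coprime)
    then obtain z where "[y * z = 1] (mod int p)"
      using cong_solve_coprime_int by blast
    then have z: "int p dvd y * z - 1"
      by (simp add: cong_iff_dvd_diff)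
    have "(x * z)\<^sup>2 + c * (x * z) + 1 =
        qf c x y * z\<^sup>2 - (y * z - 1) * (c * (x * z) + y * z + 1)"
      by (simp add: qf_def algebra_simps power2_eq_square)
    moreover have "int p dvd \<dots>"
      using dvd z by (intro dvd_diff) simp_all
    ultimately show False
      using root_not_inert[OF p c, of "x * z"] chi by simp
  qed
  moreover from this have "int p dvd qf c x y - y * (c * x + y)"
    using dvd by (intro dvd_diff) simp_all
  then have "int p dvd x ^ 2"
    by (simp add: qf_def algebra_simps power2_eq_square)
  then have "int p dvd x"
    using pi prime_dvd_power_iff by (metis prime_dvd_power)
  ultimately show ?thesis
    by simp
qed

section \<open>Multiplication in the two rings and the recurrence at a prime\<close>

definition qf_reps :: "int \<Rightarrow> int \<Rightarrow> (int \<times> int) set" where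
  "qf_reps c n = {(x, y). qf c x y = n}"

text \<open>Multiplication of \<open>x + y * w\<close> by \<open>a + b * w\<close>. The conjugate of
  \<open>a + b * w\<close> is \<open>(a + c * b) - b * w\<close>, whence the arguments
  \<open>a + c * b\<close> and \<open>- b\<close> below.\<close>

definition qmul :: "int \<Rightarrow> int \<Rightarrow> int \<Rightarrow> int \<times> int \<Rightarrow> int \<times> int" where
  "qmul c a b = (\<lambda>(x, y). (a * x - b * y, a * y + b * x + c * b * y))"

lemma qf_qmul: "qf c (a * x - b * y) (a * y + b * x + c * b * y) = qf c a b * qf c x y"
  by (simp add: qf_def power2_eq_square algebra_simps)

lemma qf_conj: "qf c (a + c * b) (- b) = qf c a b"
  by (simp add: qf_def power2_eq_square algebra_simps)

lemma qmul_conj: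
  "qmul c (a + c * b) (- b) (qmul c a b z) = (qf c a b * fst z, qf c a b * snd z)"
  "qmul c a b (qmul c (a + c * b) (- b) z) = (qf c a b * fst z, qf c a b * snd z)"
  by (simp_all add: qf_def qmul_def power2_eq_square algebra_simps case_prod_unfold)

lemma qf_scale: "qf c (k * x) (k * y) = k\<^sup>2 * qf c x y"
  by (simp add: qf_def power2_eq_square algebra_simps)

lemma inj_qmul:
  assumes "qf c a b \<noteq> 0"
  shows "inj (qmul c a b)"
proof (rule injI)
  fix z z' assume "qmul c a b z = qmul c a b z'"
  then have "qmul c (a + c * b) (- b) (qmul c a b z) = qmul c (a + c * b) (- b) (qmul c a b z')"
    by simp
  then show "z = z'"
    using assms by (simp add: qmul_conj prod_eq_iff)
qed

lemma finite_qf_reps [simp]: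
  assumes "c = 0 \<or> c = 1"
  shows "finite (qf_reps c n)"
proof (rule finite_subset)
  show "qf_reps c n \<subseteq> {- 2 * n..2 * n} \<times> {- 2 * n..2 * n}"
  proof
    fix z assume "z \<in> qf_reps c n"
    then obtain x y where z: "z = (x, y)" "qf c x y = n"
      by (auto simp: qf_reps_def)
    have "2 * n = x\<^sup>2 + y\<^sup>2 + (x + y)\<^sup>2 \<or> n = x\<^sup>2 + y\<^sup>2"
      using assms z(2) by (auto simp: qf_def power2_eq_square algebra_simps)
    then have "x\<^sup>2 \<le> 2 * n" "y\<^sup>2 \<le> 2 * n"
      using zero_le_power2[of x] zero_le_power2[of y] zero_le_power2[of "x + y"] by linarith+
    moreover have "\<bar>u\<bar> \<le> u\<^sup>2" for u :: int
    proof -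
      have "\<bar>u\<bar> * 1 \<le> \<bar>u\<bar> * \<bar>u\<bar>"
        by (cases "u = 0", simp, rule mult_left_mono) auto
      then show ?thesis
        by (simp add: power2_eq_square)
    qed
    ultimately have "\<bar>x\<bar> \<le> 2 * n" "\<bar>y\<bar> \<le> 2 * n"
      using order_trans by blast+
    with z show "z \<in> {- 2 * n..2 * n} \<times> {- 2 * n..2 * n}"
      by auto
  qed
qed simp

lemma card_qf_reps_divisible:
  assumes "0 < p"
  shows "card {(x, y) \<in> qf_reps c (p * n). p dvd x \<and> p dvd y} = (if p dvd n then card (qf_reps c (n div p)) else 0)"
proof (cases "p dvd n")
  case True
  then obtain m where m: "n = p * m"
    by (auto elim: dvdE)
  have "bij_betw (\<lambda>(x, y). (p * x, p * y)) (qf_reps c m) {(x, y) \<in> qf_reps c (p * n). p dvd x \<and> p dvd y}"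
  proof (rule bij_betw_byWitness[where f' = "\<lambda>(x, y). (x div p, y div p)"])
    show "(\<lambda>(x, y). (p * x, p * y)) ` qf_reps c m \<subseteq> {(x, y) \<in> qf_reps c (p * n). p dvd x \<and> p dvd y}"
      by (auto simp: qf_reps_def qf_scale m power2_eq_square)
    show "(\<lambda>(x, y). (x div p, y div p)) ` {(x, y) \<in> qf_reps c (p * n). p dvd x \<and> p dvd y} \<subseteq> qf_reps c m"
      using assms by (auto simp: qf_reps_def qf_scale m power2_eq_square elim!: dvdE)
  qed (use assms in auto)
  then show ?thesis
    using assms m by (simp add: bij_betw_same_card)
next
  case False
  have "{(x, y) \<in> qf_reps c (p * n). p dvd x \<and> p dvd y} = {}"
  proof (rule ccontr)
    assume "{(x, y) \<in> qf_reps c (p * n). p dvd x \<and> p dvd y} \<noteq> {}"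
    then obtain x y where "qf c (p * x) (p * y) = p * n"
      by (auto simp: qf_reps_def elim!: dvdE)
    then have "n = p * qf c x y"
      using assms by (simp add: qf_scale power2_eq_square)
    with False show False
      by simp
  qed
  then show ?thesis
    by (simp only: False if_False card.empty)
qed

text \<open>An element is a multiple of \<open>a + b * w\<close> precisely when its product with the
  conjugate is divisible by the norm \<open>p\<close>.\<close>

lemma qmul_image_qf_reps:
  assumes "qf c a b = p" "p \<noteq> 0"
  shows "qmul c a b ` qf_reps c n = {z \<in> qf_reps c (p * n). p dvd fst (qmul c (a + c * b) (- b) z) \<and>
    p dvd snd (qmul c (a + c * b) (- b) z)}" (is "_ = ?R")
proof (intro equalityI subsetI)
  fix z assume "z \<in> qmul c a b ` qf_reps c n"
  then obtain w where w: "w \<in> qf_reps c n" "z = qmul c a b w"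
    by blast
  show "z \<in> ?R"
    using w assms by (auto simp: qmul_conj(1)) (auto simp: qf_reps_def qmul_def qf_qmul)
next
  fix z assume z: "z \<in> ?R"
  then obtain u v where uv: "qmul c (a + c * b) (- b) z = (p * u, p * v)"
    by (auto simp: prod_eq_iff elim!: dvdE)
  have "qmul c a b (p * u, p * v) = (p * fst z, p * snd z)"
    using qmul_conj(2)[of c a b z] uv assms by simp
  then have z': "z = qmul c a b (u, v)"
    using assms(2) by (auto simp: qmul_def prod_eq_iff right_diff_distrib[symmetric] distrib_left[symmetric]
        mult.left_commute[of _ p])
  moreover have "(u, v) \<in> qf_reps c n"
    using z assms unfolding z' by (auto simp: qf_reps_def qmul_def qf_qmul)
  ultimately show "z \<in> qmul c a b ` qf_reps c n"
    by blast
qed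

text \<open>Inclusion-exclusion: an element of norm \<open>p * n\<close> is a multiple of
  \<open>a + b * w\<close> or of its conjugate, and it is a multiple of both only if
  \<open>p\<close> divides it.\<close>

lemma card_qf_reps_split:
  assumes p: "prime p" "odd p" and c: "c = 0 \<or> c = 1" and p3: "c = 1 \<Longrightarrow> p \<noteq> 3"
    and ab: "qf c a b = p"
  shows "card (qf_reps c (p * n)) + (if p dvd n then card (qf_reps c (n div p)) else 0) = 2 * card (qf_reps c n)"
proof -
  have p0: "0 < p" "p \<noteq> 0"
    using p(1) by (simp_all add: prime_gt_0_int)
  define A B where "A = qmul c a b ` qf_reps c n" "B = qmul c (a + c * b) (- b) ` qf_reps c n"
  note AB = this
  have ab': "qf c (a + c * b) (- b) = p"
    by (simp add: qf_conj ab)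
  have A: "A = {z \<in> qf_reps c (p * n). p dvd fst (qmul c (a + c * b) (- b) z) \<and>
      p dvd snd (qmul c (a + c * b) (- b) z)}"
    unfolding AB by (rule qmul_image_qf_reps[OF ab p0(2)])
  have B: "B = {z \<in> qf_reps c (p * n). p dvd fst (qmul c a b z) \<and> p dvd snd (qmul c a b z)}"
    unfolding AB using qmul_image_qf_reps[OF ab' p0(2), of n] by simp
  have first: "p dvd u" if "p dvd v" "qf c u v = p * (p * n)" for u v n
  proof -
    have "p dvd p * (p * n) - v * (c * u + v)"
      using that(1) by (intro dvd_diff) simp_all
    also have "p * (p * n) - v * (c * u + v) = u\<^sup>2"
      unfolding that(2)[symmetric] by (simp add: qf_def power2_eq_square algebra_simps)
    finally show ?thesis
      using p(1) prime_dvd_power by blast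
  qed
  have union: "A \<union> B = qf_reps c (p * n)"
  proof
    show "A \<union> B \<subseteq> qf_reps c (p * n)"
      by (auto simp: A B)
    show "qf_reps c (p * n) \<subseteq> A \<union> B"
    proof
      fix z assume z: "z \<in> qf_reps c (p * n)"
      obtain x y where xy: "z = (x, y)"
        by (cases z)
      have q: "qf c x y = p * n"
        using z by (simp add: xy qf_reps_def)
      \<comment> \<open>The two factors are the second coordinates of the products with the
        conjugate and with \<open>a + b * w\<close>; since \<open>p\<close> divides the right-hand
        side, it divides one of them, and \<open>first\<close> handles the other coordinate.\<close>
      have "(a * y - b * x) * (a * y + b * x + c * b * y) = y\<^sup>2 * qf c a b - b\<^sup>2 * qf c x y"
        by (simp add: qf_def power2_eq_square algebra_simps)
      then have "p dvd (a * y - b * x) * (a * y + b * x + c * b * y)"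
        by (simp add: ab q)
      then have "p dvd snd (qmul c (a + c * b) (- b) z) \<or> p dvd snd (qmul c a b z)"
        using p(1) unfolding prime_dvd_mult_iff[OF p(1)] by (simp add: xy qmul_def algebra_simps)
      moreover have "qf c (fst (qmul c a b z)) (snd (qmul c a b z)) = p * (p * n)"
        "qf c (fst (qmul c (a + c * b) (- b) z)) (snd (qmul c (a + c * b) (- b) z)) = p * (p * n)"
        using qf_qmul[of c a x b y] qf_qmul[of c "a + c * b" x "- b" y]
        by (simp_all add: xy qmul_def q ab qf_conj)
      ultimately show "z \<in> A \<union> B"
        using z first unfolding A B by blast
    qed
  qed
  have inter: "A \<inter> B = {(x, y) \<in> qf_reps c (p * n). p dvd x \<and> p dvd y}"
  proof (intro equalityI subsetI)
    fix z assume "z \<in> A \<inter> B"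
    then have z: "z \<in> qf_reps c (p * n)" and "p dvd fst (qmul c (a + c * b) (- b) z) + fst (qmul c a b z)"
      "p dvd snd (qmul c (a + c * b) (- b) z) + snd (qmul c a b z)"
      by (auto simp: A B)
    moreover obtain x y where xy: "z = (x, y)"
      by (cases z)
    ultimately have "p dvd (2 * a + c * b) * x" "p dvd (2 * a + c * b) * y"
      by (simp_all add: qmul_def algebra_simps)
    \<comment> \<open>The sum of the two products is the trace \<open>2 * a + c * b\<close> times
      \<open>z\<close>. The trace is prime to \<open>p\<close>: otherwise \<open>p\<close> would
      divide \<open>(4 - c^2) * b^2\<close>, where \<open>4 - c^2\<close> is 4 or 3.\<close>
    moreover have "\<not> p dvd 2 * a + c * b"
    proof
      assume "p dvd 2 * a + c * b"
      then have "p dvd 4 * qf c a b - (2 * a + c * b) * (2 * a + c * b)"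
        unfolding ab by (intro dvd_diff) simp_all
      also have "4 * qf c a b - (2 * a + c * b) * (2 * a + c * b) = (4 - c\<^sup>2) * b\<^sup>2"
        by (simp add: qf_def power2_eq_square algebra_simps)
      finally have "p dvd 4 - c\<^sup>2 \<or> p dvd b"
        using p(1) by (metis prime_dvd_mult_iff prime_dvd_power)
      moreover have "\<not> p dvd 4 - c\<^sup>2"
      proof
        assume dvd: "p dvd 4 - c\<^sup>2"
        show False
          using c
        proof
          assume "c = 0"
          then have "p dvd 2 ^ 2"
            using dvd by simp
          then have "p dvd 2"
            using p(1) prime_dvd_power by blast
          then show False
            using p primes_dvd_imp_eq[of p 2] by simp
        next
          assume "c = 1"
          then show False
            using dvd p p3 primes_dvd_imp_eq[of p 3] by simp
        qed
      qed
      ultimately have "p dvd b"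
        by blast
      moreover from this have "p dvd p - b * (c * a + b)"
        by (intro dvd_diff) simp_all
      then have "p dvd a\<^sup>2"
        unfolding ab[symmetric] by (simp add: qf_def power2_eq_square algebra_simps)
      then have "p dvd a"
        using p(1) prime_dvd_power by blast
      ultimately obtain k l where "a = p * k" "b = p * l"
        by (auto elim!: dvdE)
      then have "p * (p * qf c k l) = p * 1"
        using ab by (simp add: qf_scale power2_eq_square)
      then have "p dvd 1"
        using p0 by (metis dvd_triv_left mult_left_cancel)
      then show False
        using prime_gt_1_int[OF p(1)] by simp
    qed
    ultimately show "z \<in> {(x, y) \<in> qf_reps c (p * n). p dvd x \<and> p dvd y}"
      using z p(1) by (simp add: xy prime_dvd_mult_iff)
  next
    fix z assume "z \<in> {(x, y) \<in> qf_reps c (p * n). p dvd x \<and> p dvd y}"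
    then show "z \<in> A \<inter> B"
      by (auto simp: A B qmul_def)
  qed
  have "card A = card (qf_reps c n)" "card B = card (qf_reps c n)"
    unfolding AB using ab ab' p0 by (auto intro!: card_image inj_on_subset[OF inj_qmul])
  moreover have "card A + card B = card (A \<union> B) + card (A \<inter> B)"
    by (rule card_Un_Int) (simp_all add: AB c)
  ultimately show ?thesis
    unfolding union inter card_qf_reps_divisible[OF p0(1)] by simp
qed

text \<open>\<open>1 + w\<close> has norm 3 and divides every element of norm divisible by 3,
  because such an element has \<open>x\<close> and \<open>y\<close> congruent modulo 3.\<close>

lemma card_qf_reps_ramified: "card (qf_reps 1 (3 * n)) = card (qf_reps 1 n)"
proof -
  have "qmul 1 1 1 ` qf_reps 1 n = qf_reps 1 (3 * n)"
  proof -
    have "3 dvd fst (qmul 1 2 (- 1) z) \<and> 3 dvd snd (qmul 1 2 (- 1) z)" if "z \<in> qf_reps 1 (3 * n)" for z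
    proof -
      obtain x y where xy: "z = (x, y)"
        by (cases z)
      have "3 dvd qf 1 x y - 3 * x * y"
        using that by (auto simp: xy qf_reps_def intro!: dvd_diff)
      also have "qf 1 x y - 3 * x * y = (x - y)\<^sup>2"
        by (simp add: qf_def power2_eq_square algebra_simps)
      finally have "3 dvd x - y"
        using prime_dvd_power[of 3 "x - y" 2] by simp
      then obtain k where "x - y = 3 * k"
        by (rule dvdE)
      then have "x = y + 3 * k"
        by simp
      then show ?thesis
        by (simp add: xy qmul_def algebra_simps)
    qed
    then show ?thesis
      using qmul_image_qf_reps[of 1 1 1 3 n] by (auto simp: qf_def)
  qed
  moreover have "inj (qmul 1 1 1)"
    by (rule inj_qmul) (simp add: qf_def)
  ultimately show ?thesis
    using card_image[OF inj_on_subset[OF _ subset_UNIV], of "qmul 1 1 1" "qf_reps 1 n"] by simp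
qed

lemma chi_values: "chi c n \<in> {- 1, 0, 1}"
  by (simp add: chi_def chi3_def chi4_def)

text \<open>One recurrence for inert, ramified and split primes alike. \<open>sigma_chi\<close>
  satisfies the same one, so counts and divisor sums can be compared by induction without unique
  factorization in the rings.\<close>

lemma card_qf_reps_prime:
  assumes p: "prime p" "odd p" and c: "c = 0 \<or> c = 1"
  shows "int (card (qf_reps c (p * n))) + chi c p * int (if p dvd n then card (qf_reps c (n div p)) else 0) =
    (1 + chi c p) * int (card (qf_reps c n))"
proof -
  define p' where "p' = nat p"
  have p': "p = int p'" "prime p'" "odd p'"
    using p prime_gt_0_int[OF p(1)] by (auto simp: p'_def even_nat_iff)
  consider "chi c p = - 1" | "chi c p = 0" | "chi c p = 1"
    using chi_values[of c p] by auto
  then show ?thesis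
  proof cases
    case 1
    have dvd: "p dvd x \<and> p dvd y" if "(x, y) \<in> qf_reps c (p * n)" for x y
    proof -
      have "p dvd qf c x y"
        using that by (simp add: qf_reps_def)
      then show ?thesis
        using inert_dvd[OF p'(2,3) c, folded p'(1), OF 1] by blast
    qed
    have "qf_reps c (p * n) = {(x, y) \<in> qf_reps c (p * n). p dvd x \<and> p dvd y}"
      using dvd by blast
    then have "card (qf_reps c (p * n)) = card {(x, y) \<in> qf_reps c (p * n). p dvd x \<and> p dvd y}"
      by (rule arg_cong)
    then show ?thesis
      using 1 card_qf_reps_divisible[of p c n] prime_gt_0_int[OF p(1)] by simp
  next
    case 2
    have "c = 1 \<and> p = 3"
    proof (cases "c = 0")
      case True
      then have "chi4 p = 0"
        using 2 by (simp add: chi_def)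
      moreover have "p mod 4 = 1 \<or> p mod 4 = 3"
        using p(2) by presburger
      ultimately show ?thesis
        by (auto simp: chi4_def)
    next
      case False
      then have "c = 1" "chi3 p = 0"
        using c 2 by (auto simp: chi_def)
      then have "3 dvd p"
        by (auto simp: chi3_def dvd_eq_mod_eq_0 split: if_splits)
      then show ?thesis
        using \<open>c = 1\<close> p(1) primes_dvd_imp_eq[of 3 p] by simp
    qed
    with 2 show ?thesis
      by (simp add: card_qf_reps_ramified)
  next
    case 3
    then obtain a b where "qf c a b = p"
      using split_prime_represented[OF p'(2,3) c] p'(1) by auto
    moreover have "p \<noteq> 3" if "c = 1"
      using 3 that by (auto simp: chi_def chi3_def)
    ultimately show ?thesis
      using card_qf_reps_split[OF p c, of a b n] 3 by (simp split: if_splits)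
  qed
qed

section \<open>Divisor sums of a character and the class number one formula\<close>

definition sigma_chi :: "int \<Rightarrow> int \<Rightarrow> int" where
  "sigma_chi c n = (\<Sum>(d, x)\<in>factor_pairs n. chi c d)"

lemma chi_mult: "chi c (a * b) = chi c a * chi c b"
  by (simp add: chi_def chi3_mult chi4_mult)

text \<open>Inclusion-exclusion: in \<open>d * x = p * n\<close> the prime divides \<open>d\<close>
  or \<open>x\<close>. The overlap is what the second term on the left records.\<close>

lemma sigma_chi_prime:
  assumes p: "prime p"
  shows "sigma_chi c (p * n) + chi c p * (if p dvd n then sigma_chi c (n div p) else 0) =
    (1 + chi c p) * sigma_chi c n"
proof -
  have p0: "0 < p"
    using p by (rule prime_gt_0_int)
  have "(\<Sum>(d, x)\<in>factor_pairs (p * n). chi c d) + (\<Sum>(d, x)\<in>factor_pairs (p * n). if p dvd d then if p dvd x then chi c d else 0 else 0) =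
      (\<Sum>(d, x)\<in>factor_pairs (p * n). if p dvd d then chi c d else 0) + (\<Sum>(d, x)\<in>factor_pairs (p * n). if p dvd x then chi c d else 0)"
    unfolding sum.distrib[symmetric]
  proof (rule sum.cong, goal_cases)
    case (2 z)
    obtain d x where z: "z = (d, x)"
      by (cases z)
    have "p dvd d * x"
      using 2 by (auto simp: z factor_pairs_def)
    then have "p dvd d \<or> p dvd x"
      using p by (simp add: prime_dvd_mult_iff)
    then show ?case
      by (auto simp: z)
  qed simp
  also have "(\<Sum>(d, x)\<in>factor_pairs (p * n). if p dvd d then chi c d else 0) = chi c p * sigma_chi c n"
    using sum_factor_pairs_dvd_left[OF p0, of "\<lambda>d x. chi c d" n]
    by (simp add: sigma_chi_def chi_mult sum_distrib_left case_prod_unfold)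
  also have "(\<Sum>(d, x)\<in>factor_pairs (p * n). if p dvd x then chi c d else 0) = sigma_chi c n"
    using sum_factor_pairs_dvd_right[OF p0, of "\<lambda>d x. chi c d" n]
    by (simp add: sigma_chi_def)
  also have "(\<Sum>(d, x)\<in>factor_pairs (p * n). if p dvd d then if p dvd x then chi c d else 0 else 0) =
      chi c p * (\<Sum>(d, x)\<in>factor_pairs n. if p dvd x then chi c d else 0)"
    using sum_factor_pairs_dvd_left[OF p0, of "\<lambda>d x. if p dvd x then chi c d else 0" n]
    by (simp add: chi_mult sum_distrib_left case_prod_unfold if_distrib[of "\<lambda>u. chi c p * u"] cong: if_cong)
  also have "(\<Sum>(d, x)\<in>factor_pairs n. if p dvd x then chi c d else 0) = (if p dvd n then sigma_chi c (n div p) else 0)"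
  proof (cases "p dvd n")
    case True
    then obtain m where m: "n = p * m"
      by (auto elim: dvdE)
    show ?thesis
      using sum_factor_pairs_dvd_right[OF p0, of "\<lambda>d x. chi c d" m] p0 by (simp add: m sigma_chi_def)
  next
    case False
    then show ?thesis
      by (auto simp: factor_pairs_def intro!: sum.neutral)
  qed
  finally show ?thesis
    by (simp add: sigma_chi_def algebra_simps)
qed

lemma card_qf_reps_0_1: "card (qf_reps 0 1) = 4"
proof -
  have "qf_reps 0 1 = {(1, 0), (- 1, 0), (0, 1), (0, - 1)}"
  proof (intro equalityI subsetI)
    fix z assume "z \<in> qf_reps 0 1"
    then obtain x y where z: "z = (x, y)" "x\<^sup>2 + y\<^sup>2 = 1"
      by (auto simp: qf_reps_def qf_def)
    then have "x\<^sup>2 \<le> 1" "y\<^sup>2 \<le> 1"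
      using zero_le_power2[of x] zero_le_power2[of y] by linarith+
    then have "x \<in> {- 1, 0, 1}" "y \<in> {- 1, 0, 1}"
      using abs_le_square_iff[of x 1] abs_le_square_iff[of y 1] by auto
    with z show "z \<in> {(1, 0), (- 1, 0), (0, 1), (0, - 1)}"
      by auto
  qed (auto simp: qf_reps_def qf_def)
  then show ?thesis
    by simp
qed

lemma card_qf_reps_1_1: "card (qf_reps 1 1) = 6"
proof -
  have "qf_reps 1 1 = {(1, 0), (- 1, 0), (0, 1), (0, - 1), (1, - 1), (- 1, 1)}"
  proof (intro equalityI subsetI)
    fix z assume "z \<in> qf_reps 1 1"
    then obtain x y where z: "z = (x, y)" "x\<^sup>2 + x * y + y\<^sup>2 = 1"
      by (auto simp: qf_reps_def qf_def)
    then have "2 * 1 = x\<^sup>2 + y\<^sup>2 + (x + y)\<^sup>2"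
      by (simp add: power2_eq_square algebra_simps)
    then have "x\<^sup>2 \<le> 2" "y\<^sup>2 \<le> 2"
      using zero_le_power2[of x] zero_le_power2[of y] zero_le_power2[of "x + y"] by linarith+
    then have "\<bar>x\<bar> < 2" "\<bar>y\<bar> < 2"
      using power2_less_imp_less[of "\<bar>x\<bar>" 2] power2_less_imp_less[of "\<bar>y\<bar>" 2] by simp_all
    then have "x \<in> {- 1, 0, 1}" "y \<in> {- 1, 0, 1}"
      by auto
    with z show "z \<in> {(1, 0), (- 1, 0), (0, 1), (0, - 1), (1, - 1), (- 1, 1)}"
      by auto
  qed (auto simp: qf_reps_def qf_def)
  then show ?thesis
    by simp
qed

lemma factor_pairs_1: "factor_pairs 1 = {(1, 1)}"
  by (auto simp: factor_pairs_def zmult_eq_1_iff)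

text \<open>Strong induction, splitting off one prime at a time; 4 and 6 are the numbers of units,
  the counts at \<open>n = 1\<close>.\<close>

lemma card_qf_reps_eq:
  assumes "0 < n" "odd n" and c: "c = 0 \<or> c = 1"
  shows "int (card (qf_reps c n)) = (if c = 0 then 4 else 6) * sigma_chi c n"
  using assms(1,2)
proof (induction "nat n" arbitrary: n rule: less_induct)
  case less
  show ?case
  proof (cases "n = 1")
    case True
    then show ?thesis
      using c by (auto simp: card_qf_reps_0_1 card_qf_reps_1_1 sigma_chi_def factor_pairs_1 chi_def chi3_def chi4_def)
  next
    case False
    then obtain p where p: "prime p" "p dvd n"
      using prime_divisor_exists[of n] less.prems by auto
    then obtain m where m: "n = p * m"
      by (auto elim: dvdE)
    have p1: "1 < p"
      using p(1) by (rule prime_gt_1_int)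
    have mpos: "0 < m" "odd m" "odd p"
      using less.prems p1 by (auto simp: m zero_less_mult_iff)
    then have "m < n"
      using p1 by (simp add: m)
    then have IHm: "int (card (qf_reps c m)) = (if c = 0 then 4 else 6) * sigma_chi c m"
      using less.hyps mpos by simp
    have IHd: "int (card (qf_reps c (m div p))) = (if c = 0 then 4 else 6) * sigma_chi c (m div p)" if dvd: "p dvd m"
    proof -
      from dvd obtain k where k: "m = p * k"
        by (rule dvdE)
      then have "0 < k" "odd k"
        using mpos p1 by (auto simp: zero_less_mult_iff)
      moreover from this have "k < n"
        using \<open>m < n\<close> k p1 by (smt (verit) mult_le_cancel_right1)
      ultimately show ?thesis
        using less.hyps k p1 by simp
    qed
    define w :: int where "w = (if c = 0 then 4 else 6)"
    define X where "X = (if p dvd m then sigma_chi c (m div p) else 0)"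
    have "int (card (qf_reps c n)) = (1 + chi c p) * int (card (qf_reps c m)) -
        chi c p * int (if p dvd m then card (qf_reps c (m div p)) else 0)"
      using card_qf_reps_prime[OF p(1) mpos(3) c, of m] by (simp add: m)
    also have "\<dots> = (1 + chi c p) * (w * sigma_chi c m) - chi c p * (w * X)"
      using IHm IHd unfolding w_def[symmetric] by (simp add: X_def)
    also have "\<dots> = w * ((1 + chi c p) * sigma_chi c m - chi c p * X)"
      by (simp add: algebra_simps)
    also have "(1 + chi c p) * sigma_chi c m - chi c p * X = sigma_chi c n"
      using sigma_chi_prime[OF p(1), of c m] by (simp add: m X_def)
    finally show ?thesis
      by (simp add: w_def)
  qed
qed

section \<open>Representations by odd squares\<close>

lemma odd_square_mod_8:
  fixes x :: int
  assumes "odd x"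
  shows "x\<^sup>2 mod 8 = 1"
proof -
  have "x mod 8 \<in> {1, 3, 5, 7}"
    using assms by simp presburger
  then have "(x mod 8)\<^sup>2 mod 8 = 1"
    by auto
  then show ?thesis
    by (simp add: power_mod)
qed

lemma square_mod_3: "x\<^sup>2 mod 3 = (if 3 dvd x then 0 else 1 :: int)"
proof -
  have "x mod 3 \<in> {0, 1, 2}"
    by auto
  then have "(x mod 3)\<^sup>2 mod 3 = (if x mod 3 = 0 then 0 else 1)"
    by auto
  then show ?thesis
    by (simp add: power_mod dvd_eq_mod_eq_0)
qed

definition odd_pairs_1 :: "int \<Rightarrow> (int \<times> int) set" where
  "odd_pairs_1 a = {(x, y). odd x \<and> odd y \<and> x\<^sup>2 + y\<^sup>2 = 2 * a}"

definition odd_pairs_3 :: "int \<Rightarrow> (int \<times> int) set" where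
  "odd_pairs_3 a = {(z, w). odd z \<and> odd w \<and> z\<^sup>2 + 3 * w\<^sup>2 = 4 * a}"

definition odd_reps :: "int \<Rightarrow> int \<Rightarrow> int \<Rightarrow> int \<Rightarrow> int \<Rightarrow> (int \<times> int \<times> int \<times> int) set" where
  "odd_reps a b c d K = {(x, y, z, w). odd x \<and> odd y \<and> odd z \<and> odd w \<and>
     a * x\<^sup>2 + b * y\<^sup>2 + c * z\<^sup>2 + d * w\<^sup>2 = K}"

lemma card_odd_pairs_1:
  assumes "0 < a" "odd a"
  shows "int (card (odd_pairs_1 a)) = 4 * sum_chi4 a"
proof -
  have "bij_betw (\<lambda>(u, v). (u + v, u - v)) (qf_reps 0 a) (odd_pairs_1 a)"
  proof (rule bij_betw_byWitness[where f' = "\<lambda>(x, y). ((x + y) div 2, (x - y) div 2)"])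
    show "(\<lambda>(u, v). (u + v, u - v)) ` qf_reps 0 a \<subseteq> odd_pairs_1 a"
    proof clarify
      fix u v assume uv: "(u, v) \<in> qf_reps 0 a"
      then have "odd (u\<^sup>2 + v\<^sup>2)"
        using assms by (simp add: qf_reps_def qf_def)
      then have "odd (u + v)" "odd (u - v)"
        by auto
      with uv show "(u + v, u - v) \<in> odd_pairs_1 a"
        by (auto simp: odd_pairs_1_def qf_reps_def qf_def power2_eq_square algebra_simps)
    qed
    show "(\<lambda>(x, y). ((x + y) div 2, (x - y) div 2)) ` odd_pairs_1 a \<subseteq> qf_reps 0 a"
    proof clarify
      fix x y assume xy: "(x, y) \<in> odd_pairs_1 a"
      then have "even (x + y)"
        by (simp add: odd_pairs_1_def)
      then obtain u where "x + y = 2 * u"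
        by (rule evenE)
      then have y: "y = 2 * u - x"
        by simp
      show "((x + y) div 2, (x - y) div 2) \<in> qf_reps 0 a"
        using xy unfolding y by (simp add: odd_pairs_1_def qf_reps_def qf_def power2_eq_square algebra_simps)
    qed
  qed (auto simp: odd_pairs_1_def elim!: oddE)
  then have "card (odd_pairs_1 a) = card (qf_reps 0 a)"
    by (simp add: bij_betw_same_card)
  then show ?thesis
    using card_qf_reps_eq[of a 0] assms by (simp add: sigma_chi_def sum_chi4_def chi_def)
qed

text \<open>Multiplication by a primitive sixth root of unity permutes the three parity classes
  of representations cyclically.\<close>

lemma card_odd_pairs_3:
  assumes "0 < a" "odd a"
  shows "int (card (odd_pairs_3 a)) = 4 * sum_chi3 a"
proof -
  define R where "R = qf_reps 1 a"
  define U V W where "U = {(u, v) \<in> R. odd u \<and> odd v}" "V = {(u, v) \<in> R. odd u \<and> even v}"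
    "W = {(u, v) \<in> R. even u \<and> odd v}"
  note defs = this
  have fin: "finite R"
    by (simp add: R_def)
  have finU: "finite U" "finite V" "finite W"
    by (auto simp: defs intro: finite_subset[OF _ fin])
  have "R = U \<union> V \<union> W"
    using assms(2) by (auto simp: defs R_def qf_reps_def qf_def)
  moreover have "(U \<union> V) \<inter> W = {}" "U \<inter> V = {}" "U \<inter> W = {}"
    by (auto simp: defs)
  ultimately have cards: "card R = card U + card V + card W" "card (U \<union> W) = card U + card W"
    using finU by (simp_all add: card_Un_disjoint)
  have rot: "(u, v) \<in> R \<longleftrightarrow> (- v, u + v) \<in> R" "(u, v) \<in> R \<longleftrightarrow> (u + v, - u) \<in> R" for u v
    by (auto simp: R_def qf_reps_def qf_def power2_eq_square algebra_simps)
  have "bij_betw (\<lambda>(u, v). (- v, u + v)) U V"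
    by (rule bij_betw_byWitness[where f' = "\<lambda>(u, v). (u + v, - u)"]) (use rot in \<open>auto simp: defs\<close>)
  then have "card U = card V"
    by (rule bij_betw_same_card)
  have "bij_betw (\<lambda>(u, v). (- v, u + v)) V W"
    by (rule bij_betw_byWitness[where f' = "\<lambda>(u, v). (u + v, - u)"]) (use rot in \<open>auto simp: defs\<close>)
  then have "card V = card W"
    by (rule bij_betw_same_card)
  \<comment> \<open>\<open>(2 * u + v)^2 + 3 * v^2 = 4 * qf 1 u v\<close>. Odd \<open>v\<close>
    selects two of the three classes, so the factor 6 becomes 4.\<close>
  have "bij_betw (\<lambda>(u, v). (2 * u + v, v)) (U \<union> W) (odd_pairs_3 a)"
  proof (rule bij_betw_byWitness[where f' = "\<lambda>(z, w). ((z - w) div 2, w)"])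
    show "(\<lambda>(u, v). (2 * u + v, v)) ` (U \<union> W) \<subseteq> odd_pairs_3 a"
      by (auto simp: defs R_def qf_reps_def odd_pairs_3_def qf_def power2_eq_square algebra_simps)
    show "(\<lambda>(z, w). ((z - w) div 2, w)) ` odd_pairs_3 a \<subseteq> U \<union> W"
    proof clarify
      fix z w assume zw: "(z, w) \<in> odd_pairs_3 a" "((z - w) div 2, w) \<notin> W"
      then have "even (z - w)"
        by (simp add: odd_pairs_3_def)
      then obtain u where "z - w = 2 * u"
        by (rule evenE)
      then have z: "z = 2 * u + w"
        by simp
      have "(u, w) \<in> R"
        using zw(1) unfolding z
        by (simp add: odd_pairs_3_def R_def qf_reps_def qf_def power2_eq_square algebra_simps)
      then show "((z - w) div 2, w) \<in> U"
        using zw unfolding z by (auto simp: defs odd_pairs_3_def)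
    qed
  qed (auto simp: odd_pairs_3_def)
  then have "card (odd_pairs_3 a) = card (U \<union> W)"
    by (simp add: bij_betw_same_card)
  then have "3 * card (odd_pairs_3 a) = 2 * card R"
    using cards \<open>card U = card V\<close> \<open>card V = card W\<close> by simp
  then show ?thesis
    using card_qf_reps_eq[of a 1] assms by (simp add: R_def sigma_chi_def sum_chi3_def chi_def)
qed

text \<open>The congruence for N makes \<open>N - k * a\<close> twice an odd number when
  \<open>a\<close> is 1 modulo 4, so both odd-pair counts apply, each with factor 4.\<close>

lemma card_odd_reps:
  assumes k: "k = 1 \<or> k = 3" and N: "N mod 4 = (k + 2) mod 4"
  shows "int (card (odd_reps k k 1 3 (2 * N))) = 16 * chi_conv k N"
proof -
  define I where "I = {a. 0 < a \<and> k * a < N \<and> a mod 4 = 1}"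
  have I_fin: "finite I"
    by (rule finite_subset[of _ "{0..N}"]) (use k in \<open>auto simp: I_def\<close>)
  have half: "odd ((N - k * a) div 2)" "2 * ((N - k * a) div 2) = N - k * a" "0 < (N - k * a) div 2"
    if "a \<in> I" for a
  proof -
    have a: "a mod 4 = 1" "k * a < N"
      using that by (simp_all add: I_def)
    show "odd ((N - k * a) div 2)"
      using k N a by auto presburger+
    show *: "2 * ((N - k * a) div 2) = N - k * a"
      using k N a by auto presburger+
    show "0 < (N - k * a) div 2"
      using * a by linarith
  qed
  have "bij_betw (\<lambda>(a, (x, y), (z, w)). (x, y, z, w))
     (SIGMA a:I. odd_pairs_1 a \<times> odd_pairs_3 ((N - k * a) div 2)) (odd_reps k k 1 3 (2 * N))"
  proof (rule bij_betw_byWitness[where f' = "\<lambda>(x, y, z, w). ((x\<^sup>2 + y\<^sup>2) div 2, (x, y), (z, w))"])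
    show "(\<lambda>(a, (x, y), (z, w)). (x, y, z, w)) ` (SIGMA a:I. odd_pairs_1 a \<times> odd_pairs_3 ((N - k * a) div 2))
        \<subseteq> odd_reps k k 1 3 (2 * N)"
    proof clarify
      fix a x y z w
      assume *: "a \<in> I" "(x, y) \<in> odd_pairs_1 a" "(z, w) \<in> odd_pairs_3 ((N - k * a) div 2)"
      have "k * x\<^sup>2 + k * y\<^sup>2 = k * (2 * a)"
        using *(2) by (simp add: odd_pairs_1_def distrib_left[symmetric])
      moreover have "z\<^sup>2 + 3 * w\<^sup>2 = 2 * (N - k * a)"
        using *(3) half(2)[OF *(1)] by (simp add: odd_pairs_3_def)
      ultimately show "(x, y, z, w) \<in> odd_reps k k 1 3 (2 * N)"
        using * by (simp add: odd_reps_def odd_pairs_1_def odd_pairs_3_def algebra_simps)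
    qed
    show "(\<lambda>(x, y, z, w). ((x\<^sup>2 + y\<^sup>2) div 2, (x, y), (z, w))) ` odd_reps k k 1 3 (2 * N)
        \<subseteq> (SIGMA a:I. odd_pairs_1 a \<times> odd_pairs_3 ((N - k * a) div 2))"
    proof (rule image_subsetI)
      fix q assume "q \<in> odd_reps k k 1 3 (2 * N)"
      then obtain x y z w where q: "q = (x, y, z, w)" and *: "(x, y, z, w) \<in> odd_reps k k 1 3 (2 * N)"
        by (cases q) auto
      define a where "a = (x\<^sup>2 + y\<^sup>2) div 2"
      have odd: "odd x" "odd y" "odd z" "odd w" and
        eq: "k * x\<^sup>2 + k * y\<^sup>2 + z\<^sup>2 + 3 * w\<^sup>2 = 2 * N"
        using * by (simp_all add: odd_reps_def)
      have "x\<^sup>2 mod 8 = 1" "y\<^sup>2 mod 8 = 1"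
        using odd odd_square_mod_8 by blast+
      then have a: "x\<^sup>2 + y\<^sup>2 = 2 * a" "a mod 4 = 1"
        unfolding a_def by presburger+
      have "k * x\<^sup>2 + k * y\<^sup>2 = k * (2 * a)"
        unfolding a(1)[symmetric] by (simp add: distrib_left)
      then have zw: "z\<^sup>2 + 3 * w\<^sup>2 = 2 * (N - k * a)"
        using eq by simp
      have "x \<noteq> 0" "z \<noteq> 0"
        using odd by auto
      then have "0 < x\<^sup>2" "0 < z\<^sup>2" "0 \<le> y\<^sup>2" "0 \<le> w\<^sup>2"
        by simp_all
      then have "0 < a" "0 < 2 * (N - k * a)"
        unfolding zw[symmetric] using a by linarith+
      then have "0 < a" "k * a < N"
        by simp_all
      then have aI: "a \<in> I"
        using a by (simp add: I_def)
      then have "(z, w) \<in> odd_pairs_3 ((N - k * a) div 2)"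
        using odd zw half(2)[OF aI] by (simp add: odd_pairs_3_def)
      then show "(case q of (x, y, z, w) \<Rightarrow> ((x\<^sup>2 + y\<^sup>2) div 2, (x, y), (z, w)))
          \<in> (SIGMA a:I. odd_pairs_1 a \<times> odd_pairs_3 ((N - k * a) div 2))"
        using aI odd a by (simp add: q a_def[symmetric] odd_pairs_1_def)
    qed
  qed (auto simp: odd_pairs_1_def)
  then have "card (odd_reps k k 1 3 (2 * N)) =
      card (SIGMA a:I. odd_pairs_1 a \<times> odd_pairs_3 ((N - k * a) div 2))"
    by (simp add: bij_betw_same_card)
  also have "\<dots> = (\<Sum>a\<in>I. card (odd_pairs_1 a \<times> odd_pairs_3 ((N - k * a) div 2)))"
  proof (rule card_SigmaI[OF I_fin], rule ballI)
    fix a assume a: "a \<in> I"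
    show "finite (odd_pairs_1 a \<times> odd_pairs_3 ((N - k * a) div 2))"
    proof (rule finite_cartesian_product)
      show "finite (odd_pairs_1 a)"
        by (rule finite_subset[OF _ finite_qf_reps[of 0 "2 * a"]]) (auto simp: odd_pairs_1_def qf_reps_def qf_def)
      define b where "b = (N - k * a) div 2"
      have "odd_pairs_3 b \<subseteq> (\<lambda>(u, v). (2 * u + v, v)) ` qf_reps 1 b"
      proof clarify
        fix z w assume zw: "(z, w) \<in> odd_pairs_3 b"
        then have "even (z - w)"
          by (simp add: odd_pairs_3_def)
        then obtain u where "z - w = 2 * u"
          by (rule evenE)
        then have z: "z = 2 * u + w"
          by simp
        have "(u, w) \<in> qf_reps 1 b"
          using zw unfolding z by (simp add: odd_pairs_3_def qf_reps_def qf_def power2_eq_square algebra_simps)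
        then show "(z, w) \<in> (\<lambda>(u, v). (2 * u + v, v)) ` qf_reps 1 b"
          unfolding z by (intro image_eqI[of _ _ "(u, w)"]) auto
      qed
      then show "finite (odd_pairs_3 b)"
        by (rule finite_subset) simp
    qed
  qed
  finally have "int (card (odd_reps k k 1 3 (2 * N))) =
      (\<Sum>a\<in>I. int (card (odd_pairs_1 a)) * int (card (odd_pairs_3 ((N - k * a) div 2))))"
    by (simp add: card_cartesian_product)
  also have "\<dots> = (\<Sum>a\<in>I. 16 * (sum_chi4 a * sum_chi3 ((N - k * a) div 2)))"
  proof (rule sum.cong)
    fix a assume a: "a \<in> I"
    then have "0 < a" "odd a"
      by (auto simp: I_def) presburger
    then show "int (card (odd_pairs_1 a)) * int (card (odd_pairs_3 ((N - k * a) div 2))) =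
        16 * (sum_chi4 a * sum_chi3 ((N - k * a) div 2))"
      using half[OF a] by (simp add: card_odd_pairs_1 card_odd_pairs_3)
  qed simp
  finally show ?thesis
    by (simp add: chi_conv_def I_def sum_distrib_left)
qed

lemma t_eq_card_odd_reps:
  "t a b c d m = card (odd_reps (int a) (int b) (int c) (int d) (8 * int m + int (a + b + c + d)))"
proof -
  have sq: "(2 * x - 1)\<^sup>2 = 8 * (x * (x - 1) div 2) + 1" for x :: int
  proof -
    define q where "q = x * (x - 1) div 2"
    have "2 * q = x * (x - 1)"
      by (simp add: q_def)
    then show ?thesis
      unfolding q_def[symmetric] by (simp add: power2_eq_square algebra_simps)
  qed
  have eq: "int a * (2 * x - 1)\<^sup>2 + int b * (2 * y - 1)\<^sup>2 + int c * (2 * z - 1)\<^sup>2 + int d * (2 * w - 1)\<^sup>2 =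
      8 * int m + int (a + b + c + d) \<longleftrightarrow>
      int m = int a * (x * (x - 1) div 2) + int b * (y * (y - 1) div 2)
        + int c * (z * (z - 1) div 2) + int d * (w * (w - 1) div 2)" for x y z w :: int
    unfolding sq by (auto simp: algebra_simps)
  have "bij_betw (\<lambda>(x, y, z, w). (2 * x - 1, 2 * y - 1, 2 * z - 1, 2 * w - 1))
     {(x :: int, y :: int, z :: int, w :: int).
       int m = int a * (x * (x - 1) div 2) + int b * (y * (y - 1) div 2)
             + int c * (z * (z - 1) div 2) + int d * (w * (w - 1) div 2)}
     (odd_reps (int a) (int b) (int c) (int d) (8 * int m + int (a + b + c + d)))"
  proof (rule bij_betw_byWitness[where f' = "\<lambda>(x, y, z, w). ((x + 1) div 2, (y + 1) div 2, (z + 1) div 2, (w + 1) div 2)"])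
    show "(\<lambda>(x, y, z, w). ((x + 1) div 2, (y + 1) div 2, (z + 1) div 2, (w + 1) div 2)) `
        odd_reps (int a) (int b) (int c) (int d) (8 * int m + int (a + b + c + d)) \<subseteq> {(x, y, z, w).
       int m = int a * (x * (x - 1) div 2) + int b * (y * (y - 1) div 2)
             + int c * (z * (z - 1) div 2) + int d * (w * (w - 1) div 2)}"
    proof clarify
      fix x y z w
      assume *: "(x, y, z, w) \<in> odd_reps (int a) (int b) (int c) (int d) (8 * int m + int (a + b + c + d))"
      have "u = 2 * ((u + 1) div 2) - 1" if "odd u" for u :: int
        using that by presburger
      then obtain x' y' z' w' where "x = 2 * x' - 1" "y = 2 * y' - 1" "z = 2 * z' - 1" "w = 2 * w' - 1"
        using * unfolding odd_reps_def by blast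
      then show "int m = int a * ((x + 1) div 2 * ((x + 1) div 2 - 1) div 2) +
          int b * ((y + 1) div 2 * ((y + 1) div 2 - 1) div 2) +
          int c * ((z + 1) div 2 * ((z + 1) div 2 - 1) div 2) +
          int d * ((w + 1) div 2 * ((w + 1) div 2 - 1) div 2)"
        using * eq[of x' y' z' w'] by (simp add: odd_reps_def)
    qed
  qed (use eq in \<open>auto simp: odd_reps_def elim!: oddE\<close>)
  then show ?thesis
    unfolding t_def by (rule bij_betw_same_card)
qed

section \<open>Reductions by squares modulo 3\<close>

lemma mod_3_sum: "(a mod 3 + b mod 3 + c mod 3) mod 3 = (a + b + c) mod (3 :: int)"
  by presburger

text \<open>Exactly one of \<open>x\<close>, \<open>y\<close>, \<open>z\<close> is divisible by 3.
  The three choices are equally frequent, and writing that variable as 3 times another turns its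
  square into the term with coefficient 9.\<close>

lemma card_odd_reps_0_mod_3:
  assumes "K mod 3 = 2" and fin: "finite (odd_reps 1 1 1 3 K)"
  shows "card (odd_reps 1 1 1 3 K) = 3 * card (odd_reps 1 1 3 9 K)"
proof -
  define T where "T = odd_reps 1 1 1 3 K"
  define D1 D2 D3 where "D1 = {(x, y, z, w) \<in> T. 3 dvd x}" "D2 = {(x, y, z, w) \<in> T. 3 dvd y}"
    "D3 = {(x, y, z, w) \<in> T. 3 dvd z}"
  note defs = this
  have one: "(3 dvd x \<or> 3 dvd y \<or> 3 dvd z) \<and> \<not> (3 dvd x \<and> 3 dvd y) \<and>
      \<not> (3 dvd x \<and> 3 dvd z) \<and> \<not> (3 dvd y \<and> 3 dvd z)"
    if "(x, y, z, w) \<in> T" for x y z w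
  proof -
    have "x\<^sup>2 + y\<^sup>2 + z\<^sup>2 + 3 * w\<^sup>2 = K"
      using that by (simp add: T_def odd_reps_def)
    then have "(x\<^sup>2 mod 3 + y\<^sup>2 mod 3 + z\<^sup>2 mod 3) mod 3 = 2"
      unfolding mod_3_sum using assms(1) by auto
    then show ?thesis
      unfolding square_mod_3 by (auto split: if_splits)
  qed
  have "T = D1 \<union> D2 \<union> D3"
    using one by (auto simp: defs)
  moreover have "(D1 \<union> D2) \<inter> D3 = {}" "D1 \<inter> D2 = {}"
    using one by (auto simp: defs)
  moreover have "finite D1" "finite D2" "finite D3"
    by (auto simp: defs T_def intro: finite_subset[OF _ fin])
  ultimately have T: "card T = card D1 + card D2 + card D3"
    by (simp add: card_Un_disjoint)
  have "bij_betw (\<lambda>(x, y, z, w). (z, y, x, w)) D3 D1" "bij_betw (\<lambda>(x, y, z, w). (x, z, y, w)) D3 D2"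
    by (rule bij_betw_byWitness[where f' = "\<lambda>(x, y, z, w). (z, y, x, w)"],
        auto simp: defs T_def odd_reps_def)
      (rule bij_betw_byWitness[where f' = "\<lambda>(x, y, z, w). (x, z, y, w)"],
        auto simp: defs T_def odd_reps_def)
  then have "card D1 = card D3" "card D2 = card D3"
    by (auto dest: bij_betw_same_card)
  moreover have "bij_betw (\<lambda>(x, y, z, w). (x, y, w, z div 3)) D3 (odd_reps 1 1 3 9 K)"
  proof (rule bij_betw_byWitness[where f' = "\<lambda>(x, y, z, w). (x, y, 3 * w, z)"])
    show "(\<lambda>(x, y, z, w). (x, y, w, z div 3)) ` D3 \<subseteq> odd_reps 1 1 3 9 K"
    proof clarify
      fix x y z w assume "(x, y, z, w) \<in> D3"
      moreover from this obtain k where "z = 3 * k"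
        by (auto simp: defs)
      ultimately show "(x, y, w, z div 3) \<in> odd_reps 1 1 3 9 K"
        by (simp add: defs T_def odd_reps_def)
    qed
  qed (auto simp: defs T_def odd_reps_def)
  then have "card D3 = card (odd_reps 1 1 3 9 K)"
    by (rule bij_betw_same_card)
  ultimately show ?thesis
    using T unfolding T_def by simp
qed

text \<open>Now exactly one of \<open>x\<close>, \<open>y\<close>, \<open>z\<close> is prime to 3 in
  the form with coefficients 1, 1, 1, 3, and exactly one of \<open>x\<close>, \<open>y\<close> in
  the other. The classes \<open>D3\<close> and \<open>E1\<close> correspond; they make up a third
  and a half of the respective totals.\<close>

lemma card_odd_reps_1_mod_3:
  assumes "K mod 3 = 1" and fin: "finite (odd_reps 1 1 1 3 K)" "finite (odd_reps 1 1 3 9 K)"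
  shows "2 * card (odd_reps 1 1 1 3 K) = 3 * card (odd_reps 1 1 3 9 K)"
proof -
  define T where "T = odd_reps 1 1 1 3 K"
  define S where "S = odd_reps 1 1 3 9 K"
  define D1 D2 D3 where "D1 = {(x, y, z, w) \<in> T. \<not> 3 dvd x}" "D2 = {(x, y, z, w) \<in> T. \<not> 3 dvd y}"
    "D3 = {(x, y, z, w) \<in> T. \<not> 3 dvd z}"
  define E1 E2 where "E1 = {(x, y, z, w) \<in> S. 3 dvd x}" "E2 = {(x, y, z, w) \<in> S. 3 dvd y}"
  note defs = D1_D2_D3_def E1_E2_def
  have one: "\<not> (3 dvd x \<and> 3 dvd y \<and> 3 dvd z) \<and> (3 dvd x \<or> 3 dvd y) \<and>
      (3 dvd x \<or> 3 dvd z) \<and> (3 dvd y \<or> 3 dvd z)"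
    if "(x, y, z, w) \<in> T" for x y z w
  proof -
    have "x\<^sup>2 + y\<^sup>2 + z\<^sup>2 + 3 * w\<^sup>2 = K"
      using that by (simp add: T_def odd_reps_def)
    then have "(x\<^sup>2 mod 3 + y\<^sup>2 mod 3 + z\<^sup>2 mod 3) mod 3 = 1"
      unfolding mod_3_sum using assms(1) by auto
    then show ?thesis
      unfolding square_mod_3 by (auto split: if_splits)
  qed
  have one': "3 dvd x \<longleftrightarrow> \<not> 3 dvd y"
    if "(x, y, z, w) \<in> S" for x y z w
  proof -
    have "x\<^sup>2 + y\<^sup>2 + 3 * (z\<^sup>2 + 3 * w\<^sup>2) = K"
      using that by (simp add: S_def odd_reps_def)
    then have "(x\<^sup>2 + y\<^sup>2) mod 3 = 1"
      using assms(1) mod_mult_self2[of "x\<^sup>2 + y\<^sup>2" 3 "z\<^sup>2 + 3 * w\<^sup>2"] by argo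
    then have "(x\<^sup>2 mod 3 + y\<^sup>2 mod 3) mod 3 = 1"
      by (simp only: mod_add_eq)
    then show ?thesis
      unfolding square_mod_3 by (auto split: if_splits)
  qed
  have "T = D1 \<union> D2 \<union> D3"
    using one by (auto simp: defs)
  moreover have "(D1 \<union> D2) \<inter> D3 = {}" "D1 \<inter> D2 = {}"
    using one by (auto simp: defs)
  moreover have "finite D1" "finite D2" "finite D3"
    by (auto simp: defs T_def intro: finite_subset[OF _ fin(1)])
  ultimately have T: "card T = card D1 + card D2 + card D3"
    by (simp add: card_Un_disjoint)
  have "S = E1 \<union> E2" "E1 \<inter> E2 = {}"
    using one' by (auto simp: defs)
  moreover have "finite E1" "finite E2"
    by (auto simp: defs S_def intro: finite_subset[OF _ fin(2)])
  ultimately have S: "card S = card E1 + card E2"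
    by (simp add: card_Un_disjoint)
  have "bij_betw (\<lambda>(x, y, z, w). (z, y, x, w)) D3 D1" "bij_betw (\<lambda>(x, y, z, w). (x, z, y, w)) D3 D2"
    by (rule bij_betw_byWitness[where f' = "\<lambda>(x, y, z, w). (z, y, x, w)"],
        auto simp: defs T_def odd_reps_def)
      (rule bij_betw_byWitness[where f' = "\<lambda>(x, y, z, w). (x, z, y, w)"],
        auto simp: defs T_def odd_reps_def)
  then have "card D1 = card D3" "card D2 = card D3"
    by (auto dest: bij_betw_same_card)
  moreover have "bij_betw (\<lambda>(x, y, z, w). (y, x, z, w)) E1 E2"
    by (rule bij_betw_byWitness[where f' = "\<lambda>(x, y, z, w). (y, x, z, w)"])
        (auto simp: defs S_def odd_reps_def)
  then have "card E1 = card E2"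
    by (rule bij_betw_same_card)
  moreover have "bij_betw (\<lambda>(x, y, z, w). (x, z, w, y div 3)) D3 E1"
  proof (rule bij_betw_byWitness[where f' = "\<lambda>(x, y, z, w). (x, 3 * w, y, z)"])
    have dvd: "3 dvd x \<and> 3 dvd y" if "(x, y, z, w) \<in> D3" for x y z w
      using one[of x y z w] that by (auto simp: defs)
    show "\<forall>p\<in>D3. (case (case p of (x, y, z, w) \<Rightarrow> (x, z, w, y div 3)) of (x, y, z, w) \<Rightarrow> (x, 3 * w, y, z)) = p"
      using dvd by auto
    show "(\<lambda>(x, y, z, w). (x, z, w, y div 3)) ` D3 \<subseteq> E1"
    proof clarify
      fix x y z w assume D3: "(x, y, z, w) \<in> D3"
      then obtain k where "y = 3 * k"
        using dvd by blast
      then show "(x, z, w, y div 3) \<in> E1"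
        using D3 dvd[OF D3] by (simp add: defs S_def T_def odd_reps_def)
    qed
    show "(\<lambda>(x, y, z, w). (x, 3 * w, y, z)) ` E1 \<subseteq> D3"
    proof clarify
      fix x y z w assume E1: "(x, y, z, w) \<in> E1"
      then have "\<not> 3 dvd y"
        using one'[of x y z w] by (simp add: defs)
      then show "(x, 3 * w, y, z) \<in> D3"
        using E1 by (simp add: defs S_def T_def odd_reps_def)
    qed
  qed auto
  then have "card D3 = card E1"
    by (rule bij_betw_same_card)
  ultimately show ?thesis
    using T S unfolding T_def S_def by simp
qed

text \<open>-1 is not a square modulo 3, so \<open>x\<close> and \<open>y\<close> are both divisible
  by 3, and the whole equation can then be divided by 3.\<close>

lemma card_odd_reps_div_3: "card (odd_reps 1 1 3 9 (3 * K)) = card (odd_reps 3 3 1 3 K)"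
proof -
  have dvd: "3 dvd x \<and> 3 dvd y" if "(x, y, z, w) \<in> odd_reps 1 1 3 9 (3 * K)" for x y z w
  proof -
    have "x\<^sup>2 + y\<^sup>2 = 3 * (K - z\<^sup>2 - 3 * w\<^sup>2)"
      using that by (simp add: odd_reps_def)
    then have "(x\<^sup>2 mod 3 + y\<^sup>2 mod 3) mod 3 = 0"
      by (simp add: mod_simps)
    then show ?thesis
      unfolding square_mod_3 by (auto split: if_splits)
  qed
  have "bij_betw (\<lambda>(x, y, z, w). (x div 3, y div 3, z, w)) (odd_reps 1 1 3 9 (3 * K)) (odd_reps 3 3 1 3 K)"
  proof (rule bij_betw_byWitness[where f' = "\<lambda>(x, y, z, w). (3 * x, 3 * y, z, w)"])
    show "\<forall>p\<in>odd_reps 1 1 3 9 (3 * K). (\<lambda>(x, y, z, w). (3 * x, 3 * y, z, w))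
        ((\<lambda>(x, y, z, w). (x div 3, y div 3, z, w)) p) = p"
      using dvd by fastforce
    show "(\<lambda>(x, y, z, w). (x div 3, y div 3, z, w)) ` odd_reps 1 1 3 9 (3 * K) \<subseteq> odd_reps 3 3 1 3 K"
    proof clarify
      fix x y z w assume *: "(x, y, z, w) \<in> odd_reps 1 1 3 9 (3 * K)"
      then obtain x' y' where "x = 3 * x'" "y = 3 * y'"
        using dvd by (meson dvdE)
      with * show "(x div 3, y div 3, z, w) \<in> odd_reps 3 3 1 3 K"
        by (simp add: odd_reps_def)
    qed
    show "(\<lambda>(x, y, z, w). (3 * x, 3 * y, z, w)) ` odd_reps 3 3 1 3 K \<subseteq> odd_reps 1 1 3 9 (3 * K)"
      by (auto simp: odd_reps_def)
  qed auto
  then show ?thesis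
    by (rule bij_betw_same_card)
qed

lemma finite_odd_reps:
  assumes "1 \<le> a" "1 \<le> b" "1 \<le> c" "1 \<le> d"
  shows "finite (odd_reps a b c d K)"
proof (rule finite_subset)
  show "odd_reps a b c d K \<subseteq> {- K..K} \<times> {- K..K} \<times> {- K..K} \<times> {- K..K}"
  proof
    fix q assume "q \<in> odd_reps a b c d K"
    then obtain x y z w where q: "q = (x, y, z, w)" and *: "(x, y, z, w) \<in> odd_reps a b c d K"
      by (cases q) auto
    have sq: "\<bar>u\<bar> \<le> k * u\<^sup>2" if "1 \<le> k" for k u :: int
    proof -
      have "\<bar>u\<bar> * 1 \<le> \<bar>u\<bar> * \<bar>u\<bar>"
        by (cases "u = 0", simp, rule mult_left_mono) auto
      also have "\<dots> = 1 * u\<^sup>2"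
        by (simp add: power2_eq_square)
      also have "\<dots> \<le> k * u\<^sup>2"
        using that by (intro mult_right_mono) auto
      finally show ?thesis
        by simp
    qed
    have "a * x\<^sup>2 + b * y\<^sup>2 + c * z\<^sup>2 + d * w\<^sup>2 = K"
      using * by (simp add: odd_reps_def)
    then have "\<bar>x\<bar> \<le> K \<and> \<bar>y\<bar> \<le> K \<and> \<bar>z\<bar> \<le> K \<and> \<bar>w\<bar> \<le> K"
      using sq[of a x] sq[of b y] sq[of c z] sq[of d w] assms by linarith
    then show "q \<in> {- K..K} \<times> {- K..K} \<times> {- K..K} \<times> {- K..K}"
      by (auto simp: q)
  qed
qed simp

section \<open>Divisor sums twisted by the character modulo 12\<close>

definition divsum :: "int \<Rightarrow> int" where
  "divsum N = (\<Sum>(d, x)\<in>factor_pairs N. d * chi12 d)"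

definition codivsum :: "int \<Rightarrow> int" where
  "codivsum N = (\<Sum>(d, x)\<in>factor_pairs N. x * chi12 d)"

lemma chi12_mult: "chi12 (a * b) = chi12 a * chi12 b"
  by (simp add: chi12_def chi3_mult chi4_mult)

lemma chi12_square: "chi12 a \<noteq> 0 \<Longrightarrow> chi12 a * chi12 a = 1"
  unfolding chi12_def chi3_def chi4_def by (simp split: if_splits)

lemma chi12_eq_0: "3 dvd a \<Longrightarrow> chi12 a = 0"
  by (simp add: chi12_def chi3_def)

text \<open>On the divisors of N the values of \<open>chi12\<close> are signs, so
  \<open>chi12 x = chi12 N * chi12 d\<close> for complementary \<open>d\<close> and
  \<open>x\<close>.\<close>

lemma codivsum_coprime:
  assumes "chi12 N \<noteq> 0"
  shows "codivsum N = chi12 N * divsum N"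
proof -
  have "codivsum N = (\<Sum>(d, x)\<in>factor_pairs N. d * chi12 x)"
    unfolding codivsum_def by (rule sum_factor_pairs_swap)
  also have "\<dots> = (\<Sum>(d, x)\<in>factor_pairs N. chi12 N * (d * chi12 d))"
  proof (rule sum.cong)
    fix z assume z: "z \<in> factor_pairs N"
    obtain d x where dx: "z = (d, x)"
      by (cases z)
    have N: "chi12 N = chi12 d * chi12 x"
      using z by (auto simp: dx factor_pairs_def chi12_mult)
    then have "chi12 d * chi12 d = 1"
      using assms by (intro chi12_square) auto
    then have "chi12 N * chi12 d = chi12 x"
      by (simp add: N mult.commute mult.assoc[symmetric])
    then show "(case z of (d, x) \<Rightarrow> d * chi12 x) = (case z of (d, x) \<Rightarrow> chi12 N * (d * chi12 d))"
      by (simp add: dx mult.left_commute)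
  qed simp
  finally show ?thesis
    by (simp add: divsum_def sum_distrib_left case_prod_unfold)
qed

text \<open>\<open>chi12\<close> vanishes at multiples of 3, so in every surviving term
  \<open>x\<close> carries the additional factor 3.\<close>

lemma sum_factor_pairs_triple:
  "(\<Sum>(d, x)\<in>factor_pairs (3 * N). f x d * chi12 d) = (\<Sum>(d, x)\<in>factor_pairs N. f (3 * x) d * chi12 d)"
proof -
  have "f x d * chi12 d = (if 3 dvd x then f x d * chi12 d else 0)" if "(d, x) \<in> factor_pairs (3 * N)" for d x
  proof -
    have "3 dvd d * x"
      using that by (simp add: factor_pairs_def)
    then have "3 dvd d \<or> 3 dvd x"
      by (simp add: prime_dvd_mult_iff)
    then show ?thesis
      by (auto simp: chi12_eq_0)
  qed
  then have "(\<Sum>(d, x)\<in>factor_pairs (3 * N). f x d * chi12 d) =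
      (\<Sum>(d, x)\<in>factor_pairs (3 * N). if 3 dvd x then f x d * chi12 d else 0)"
    by (intro sum.cong) auto
  then show ?thesis
    by (simp add: sum_factor_pairs_dvd_right)
qed

lemma divsum_power_3: "divsum (3 ^ k * N) = divsum N"
proof (induction k)
  case (Suc k)
  then show ?case
    using sum_factor_pairs_triple[of "\<lambda>x d. d" "3 ^ k * N"] by (simp add: divsum_def mult.assoc)
qed simp

lemma codivsum_power_3: "codivsum (3 ^ k * N) = 3 ^ k * codivsum N"
proof (induction k)
  case (Suc k)
  have "codivsum (3 * (3 ^ k * N)) = 3 * codivsum (3 ^ k * N)"
    using sum_factor_pairs_triple[of "\<lambda>x d. x" "3 ^ k * N"]
    by (simp add: codivsum_def sum_distrib_left case_prod_unfold mult.assoc)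
  then show ?case
    by (simp add: Suc.IH mult.assoc)
qed simp

section \<open>The symbol (3/d) as a character modulo 12\<close>

lemma Legendre_3:
  fixes p :: nat
  assumes p: "prime p" "odd p"
  shows "Legendre 3 (int p) = chi12 (int p)"
proof (cases "p = 3")
  case True
  then show ?thesis
    by (simp add: Legendre_def chi12_def chi3_def cong_def)
next
  case False
  have "2 < p"
    using p prime_ge_2_nat[of p] by (cases "p = 2") auto
  then have QR: "Legendre (int p) 3 * Legendre 3 (int p) = (- 1) ^ ((p - 1) div 2)"
    using Quadratic_Reciprocity[of p 3] p False by simp
  have sq: "[y\<^sup>2 \<noteq> 2] (mod 3)" for y :: int
    using square_mod_3[of y] by (simp add: cong_def)
  have "\<not> 3 dvd p"
    using p False primes_dvd_imp_eq[of 3 p] by auto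
  then have "int p mod 3 = 1 \<or> int p mod 3 = 2"
    by presburger
  then have L: "Legendre (int p) 3 = chi3 (int p)" "chi3 (int p) * chi3 (int p) = 1"
  proof (atomize(full), elim disjE)
    assume 1: "int p mod 3 = 1"
    then have "QuadRes 3 (int p)"
      unfolding QuadRes_def by (intro exI[of _ 1]) (simp add: cong_def)
    with 1 show "Legendre (int p) 3 = chi3 (int p) \<and> chi3 (int p) * chi3 (int p) = 1"
      by (simp add: Legendre_def chi3_def cong_def)
  next
    assume 2: "int p mod 3 = 2"
    then have "\<not> QuadRes 3 (int p)"
      using sq by (simp add: QuadRes_def cong_def)
    with 2 show "Legendre (int p) 3 = chi3 (int p) \<and> chi3 (int p) * chi3 (int p) = 1"
      by (simp add: Legendre_def chi3_def cong_def)
  qed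
  have "(- 1) ^ ((p - 1) div 2) = chi4 (int p)"
  proof -
    have "int p mod 4 = 1 \<and> even ((p - 1) div 2) \<or> int p mod 4 = 3 \<and> odd ((p - 1) div 2)"
      using p(2) by presburger
    then show ?thesis
      by (auto simp: chi4_def)
  qed
  then have "chi3 (int p) * chi3 (int p) * Legendre 3 (int p) = chi3 (int p) * chi4 (int p)"
    using QR L(1) by (simp add: mult.assoc)
  then show ?thesis
    by (simp add: L(2) chi12_def)
qed

text \<open>By multiplicativity this reduces to odd primes, where quadratic reciprocity applies. At
  2 the two sides differ, (3/2) being -1 and \<open>chi12 2\<close> being 0; all divisors of
  \<open>4 * n + 7\<close> are odd.\<close>

lemma kronecker_3:
  fixes d :: nat
  assumes "odd d"
  shows "kronecker 3 (int d) = chi12 (int d)"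
proof -
  have d0: "d \<noteq> 0"
    using assms by (cases d) auto
  have one: "chi12 1 = 1"
    by (simp add: chi12_def chi3_def chi4_def)
  have pow: "chi12 (a ^ k) = chi12 a ^ k" for a k
    by (induction k) (simp_all add: one chi12_mult)
  have prod: "chi12 (\<Prod>p\<in>A. f p) = (\<Prod>p\<in>A. chi12 (f p))" for A and f :: "nat \<Rightarrow> int"
    by (induction A rule: infinite_finite_induct) (simp_all add: one chi12_mult)
  have "kronecker 3 (int d) = (\<Prod>p\<in>prime_factors d. kronecker_prime 3 p ^ multiplicity p d)"
    using d0 by (simp add: kronecker_def)
  also have "\<dots> = (\<Prod>p\<in>prime_factors d. chi12 (int p) ^ multiplicity p d)"
  proof (rule prod.cong)
    fix p assume "p \<in> prime_factors d"
    then have "prime p" "odd p"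
      using assms by (auto simp: in_prime_factors_iff)
    moreover from this have "p \<noteq> 2"
      by auto
    ultimately show "kronecker_prime 3 p ^ multiplicity p d = chi12 (int p) ^ multiplicity p d"
      by (simp add: kronecker_prime_def Legendre_3)
  qed simp
  also have "\<dots> = chi12 (int (\<Prod>p\<in>prime_factors d. p ^ multiplicity p d))"
    by (simp add: prod pow)
  also have "(\<Prod>p\<in>prime_factors d. p ^ multiplicity p d) = d"
    using d0 by (simp add: prime_factorization_nat[symmetric])
  finally show ?thesis .
qed

lemma divsum_eq:
  fixes N :: nat
  assumes "odd N"
  shows "(\<Sum>d | d dvd N. real d * of_int (kronecker 3 (int d))) = of_int (divsum (int N))"
proof -
  have N0: "N \<noteq> 0"
    using assms by (cases N) auto
  have "(\<Sum>d | d dvd N. real d * of_int (kronecker 3 (int d))) =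
      (\<Sum>d | d dvd N. of_int (int d * chi12 (int d)))"
  proof (rule sum.cong)
    fix d assume "d \<in> {d. d dvd N}"
    then have "odd d"
      using assms by auto
    then show "real d * of_int (kronecker 3 (int d)) = of_int (int d * chi12 (int d))"
      by (simp add: kronecker_3)
  qed simp
  also have "\<dots> = of_int (\<Sum>d | d dvd N. int d * chi12 (int d))"
    by simp
  also have "(\<Sum>d | d dvd N. int d * chi12 (int d)) = divsum (int N)"
    unfolding divsum_def
  proof (rule sum.reindex_bij_witness[of _ "\<lambda>(d, x). nat d" "\<lambda>d. (int d, int (N div d))"])
    fix z assume z: "z \<in> factor_pairs (int N)"
    then obtain d x where dx: "z = (d, x)" "0 < d" "0 < x" "d * x = int N"
      by (auto simp: factor_pairs_def)
    define d' x' where "d' = nat d" "x' = nat x"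
    have d'x': "d = int d'" "x = int x'" "0 < d'"
      using dx by (simp_all add: d'_x'_def)
    then have N: "N = d' * x'"
      using dx(4) by (metis of_nat_eq_iff of_nat_mult)
    show "(int (case z of (d, x) \<Rightarrow> nat d), int (N div (case z of (d, x) \<Rightarrow> nat d))) = z"
      "(case z of (d, x) \<Rightarrow> nat d) \<in> {d. d dvd N}"
      using d'x'(3) by (simp_all add: dx(1) d'x' N)
  next
    fix d assume "d \<in> {d. d dvd N}"
    then show "(int d, int (N div d)) \<in> factor_pairs (int N)"
      using N0 by (auto simp: factor_pairs_def elim!: dvdE)
  qed auto
  finally show ?thesis .
qed

theorem theorem2p3:
  fixes n :: nat
  assumes "n \<ge> 1"
  shows "(3 dvd int n \<longrightarrow>
            real (t 1 1 3 9 n) =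
              - (8 / 3) * (\<Sum>d | d dvd 4 * n + 7. real d * of_int (kronecker 3 (int d)))) \<and>
         (3 dvd int n - 1 \<longrightarrow>
            real (t 1 1 3 9 n) =
              8 / 3 * (\<Sum>d | d dvd 4 * n + 7. real d * of_int (kronecker 3 (int d)))) \<and>
         (3 dvd int n - 2 \<longrightarrow>
            (\<forall>\<beta> n1 :: nat. 4 * n + 7 = 3 ^ \<beta> * n1 \<and> \<not> 3 dvd n1 \<longrightarrow>
              real (t 1 1 3 9 n) =
                2 * (3 powi (int \<beta> - 1) * of_int (kronecker 3 (int n1)) - 1) *
                (\<Sum>d | d dvd n1. real d * of_int (kronecker 3 (int d)))))"
proof -
  define N where "N = 4 * int n + 7"
  have N: "N mod 4 = 3" "int (4 * n + 7) = N"
    unfolding N_def by presburger simp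
  have t: "t 1 1 3 9 n = card (odd_reps 1 1 3 9 (2 * N))"
    by (simp add: t_eq_card_odd_reps N_def algebra_simps)
  have fin: "finite (odd_reps 1 1 1 3 K)" "finite (odd_reps 1 1 3 9 K)" for K
    by (simp_all add: finite_odd_reps)
  have sum: "(\<Sum>d | d dvd 4 * n + 7. real d * of_int (kronecker 3 (int d))) = of_int (divsum N)"
    using divsum_eq[of "4 * n + 7"] unfolding N(2) by simp
  \<comment> \<open>The count is 16 times \<open>chi_conv 1 N\<close>, and \<open>chi_conv_1\<close>
    evaluates 8 times it.\<close>
  have T: "int (card (odd_reps 1 1 1 3 (2 * N))) = 6 * codivsum N - 2 * divsum N"
    using card_odd_reps[of 1 N] chi_conv_1[of N] N(1) by (simp add: divsum_def codivsum_def)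
  show ?thesis
  proof (intro conjI impI allI)
    assume "3 dvd int n"
    then have N12: "N mod 12 = 7"
      unfolding N_def by presburger
    have "chi12 N = - 1"
      using chi12_mod[of N] by (simp add: N12 chi12_def chi3_def chi4_def)
    moreover have "(2 * N) mod 3 = 2"
      using N12 by presburger
    \<comment> \<open>Here \<open>codivsum N = - divsum N\<close>, so \<open>T\<close> becomes -6 -
      2 = -8 times \<open>divsum N\<close>.\<close>
    ultimately have "3 * int (t 1 1 3 9 n) = - 8 * divsum N"
      using card_odd_reps_0_mod_3[OF _ fin(1)] T codivsum_coprime[of N] unfolding t by simp
    from arg_cong[OF this, of real_of_int] have "3 * real (t 1 1 3 9 n) = - 8 * of_int (divsum N)"
      by simp
    then show "real (t 1 1 3 9 n) =
        - (8 / 3) * (\<Sum>d | d dvd 4 * n + 7. real d * of_int (kronecker 3 (int d)))"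
      unfolding sum by simp
  next
    assume "3 dvd int n - 1"
    then have N12: "N mod 12 = 11"
      unfolding N_def by presburger
    have "chi12 N = 1"
      using chi12_mod[of N] by (simp add: N12 chi12_def chi3_def chi4_def)
    then have "codivsum N = divsum N"
      using codivsum_coprime[of N] by simp
    moreover have "2 * N mod 3 = 1"
      using N12 by presburger
    note card_odd_reps_1_mod_3[OF this fin]
    ultimately have "3 * int (t 1 1 3 9 n) = 8 * divsum N"
      using T unfolding t by linarith
    from arg_cong[OF this, of real_of_int] have "3 * real (t 1 1 3 9 n) = 8 * of_int (divsum N)"
      by simp
    then show "real (t 1 1 3 9 n) =
        8 / 3 * (\<Sum>d | d dvd 4 * n + 7. real d * of_int (kronecker 3 (int d)))"
      unfolding sum by simp
  next
    fix \<beta> n1 :: nat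
    assume n: "3 dvd int n - 2" and "4 * n + 7 = 3 ^ \<beta> * n1 \<and> \<not> 3 dvd n1"
    then have n1: "4 * n + 7 = 3 ^ \<beta> * n1" "\<not> 3 dvd n1"
      by simp_all
    have "3 dvd 4 * n + 7"
      using n by presburger
    then have "\<beta> \<noteq> 0"
      using n1 by (intro notI) simp
    then obtain k where k: "\<beta> = Suc k"
      by (cases \<beta>) auto
    have "odd n1"
    proof
      assume "even n1"
      then have "even (4 * n + 7)"
        unfolding n1(1) by simp
      then show False
        by simp
    qed
    \<comment> \<open>\<open>M\<close> is N / 3, with \<open>k\<close> one less than the exponent of
      3 in N; this is the source of the exponent in the statement.\<close>
    define M where "M = 3 ^ k * int n1"
    have NM: "N = 3 * M"
      using n1(1) unfolding N(2)[symmetric] by (simp add: M_def k)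
    then have M: "M mod 4 = 1"
      using N(1) by presburger
    have "chi12 (int n1) \<noteq> 0"
    proof -
      have "int n1 mod 3 = 1 \<or> int n1 mod 3 = 2" "int n1 mod 4 = 1 \<or> int n1 mod 4 = 3"
        using n1(2) \<open>odd n1\<close> by presburger+
      then show ?thesis
        by (auto simp: chi12_def chi3_def chi4_def)
    qed
    then have "codivsum M = 3 ^ k * (chi12 (int n1) * divsum (int n1))"
      by (simp add: M_def codivsum_power_3 codivsum_coprime)
    moreover have "divsum M = divsum (int n1)"
      by (simp add: M_def divsum_power_3)
    moreover have "int (t 1 1 3 9 n) = 2 * codivsum M - 2 * divsum M"
      using card_odd_reps[of 3 M] chi_conv_3[of M] M card_odd_reps_div_3[of "2 * M"]
      unfolding t NM by (simp add: divsum_def codivsum_def)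
    ultimately have "int (t 1 1 3 9 n) = 2 * (3 ^ k * chi12 (int n1) - 1) * divsum (int n1)"
      by (simp add: algebra_simps)
    from arg_cong[OF this, of real_of_int]
    have "real (t 1 1 3 9 n) = of_int (2 * (3 ^ k * chi12 (int n1) - 1) * divsum (int n1))"
      by simp
    then show "real (t 1 1 3 9 n) = 2 * (3 powi (int \<beta> - 1) * of_int (kronecker 3 (int n1)) - 1) *
        (\<Sum>d | d dvd n1. real d * of_int (kronecker 3 (int d)))"
      using \<open>odd n1\<close> by (simp add: divsum_eq kronecker_3 k)
  qed
qed

end
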